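(* Let $l_1,l_2\ge1$ be integers, $l=l_1+l_2$, $n\ge l$, and let $\Sigma=\begin{bmatrix}\Sigma_{11}&O\\ O&\Sigma_{22}\end{bmatrix}\in\mathbb{R}^{l\times l}$ be positive definite with $\Sigma_{11}\in\mathbb{R}^{l_1\times l_1}$, $\Sigma_{22}\in\mathbb{R}^{l_2\times l_2}$. Let $p(A_{12}\mid A_{11},A_{22})$ denote the conditional distribution of the off-diagonal block given the diagonal blocks when $A=\begin{bmatrix}A_{11}&A_{12}\\ A_{12}^T&A_{22}\end{bmatrix}\sim\mathcal{W}_l(n,\Sigma)$ (partitioned conformally with $\Sigma$). Fix positive definite matrices $A_{11}\in\mathbb{R}^{l_1\times l_1}$ and $A_{22}\in\mathbb{R}^{l_2\times l_2}$. Let $S\sim\mathcal{W}_{l_2}(n-l_1,I_{l_2})$ and $X\sim\mathcal{N}_{l_2,l_1}(0,I_{l_2}\otimes I_{l_1})$ be independent random matrices. If $$A_{12}^T=(A_{22})^{\frac12}(S+XX^T)^{-\frac12}X(A_{11})^{\frac12},$$ then $A_{12}$ is distributed according to $p(A_{12}\mid A_{11},A_{22})$.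
   Context: $\mathcal{W}_l(n,\Sigma)$ (with $n\ge l$, $\Sigma>0$) is the Wishart distribution on positive definite symmetric $l\times l$ matrices with density $$p(A)=\frac{|A|^{\frac{n-l-1}{2}}\exp\left(-\frac12\mathrm{tr}(\Sigma^{-1}A)\right)}{2^{\frac{ln}{2}}|\Sigma|^{\frac n2}\Gamma_l(\frac n2)},\qquad \Gamma_l(a)=\pi^{l(l-1)/4}\prod_{j=1}^l\Gamma\left(a-\tfrac12(j-1)\right),$$ with respect to Lebesgue measure on the entries on and above the diagonal; $|\cdot|$ is the determinant. $X\sim\mathcal{N}_{q,m}(0,I_q\otimes I_m)$ means that $X$ is a $q\times m$ random matrix with i.i.d. standard normal entries. The conditional density is the ratio $p(A_{12}\mid A_{11},A_{22})=p(A)/p(A_{11},A_{22})$, where $p(A_{11},A_{22})$ is the joint marginal density of the diagonal blocks, with $A_{12}$ ranging over the matrices for which $A$ is positive definite. $(A_{11})^{1/2}$ and $(A_{22})^{1/2}$ are the symmetric positive definite square roots. $(S+XX^T)^{-1/2}$ is the inverse of $(S+XX^T)^{1/2}$, a square root satisfying $S+XX^T=(S+XX^T)^{1/2}\left((S+XX^T)^{1/2}\right)^T$ and determined as a fixed measurable function of the matrix $S+XX^T$ (for instance the symmetric positive definite square root). *)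

theory Defs
  imports "HOL-Probability.Probability"
begin

definition posdef_mat :: "real^'n^'n \<Rightarrow> bool" where
  "posdef_mat A \<longleftrightarrow> transpose A = A \<and> (\<forall>x. x \<noteq> 0 \<longrightarrow> x \<bullet> (A *v x) > 0)"

definition posdef_sqrt :: "real^'n^'n \<Rightarrow> real^'n^'n" where
  "posdef_sqrt A = (THE B. posdef_mat B \<and> B ** B = A)"

definition block_mat ::
  "real^'a^'a \<Rightarrow> real^'b^'a \<Rightarrow> real^'a^'b \<Rightarrow> real^'b^'b \<Rightarrow> real^('a + 'b)^('a + 'b)" where
  "block_mat A B C D = (\<chi> i j. case i of
      Inl a \<Rightarrow> (case j of Inl a' \<Rightarrow> A $ a $ a' | Inr b' \<Rightarrow> B $ a $ b')
    | Inr b \<Rightarrow> (case j of Inl a' \<Rightarrow> C $ b $ a' | Inr b' \<Rightarrow> D $ b $ b'))"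

text \<open>
  Lebesgue measure on the entries on and above the diagonal of a symmetric matrix, as a measure on
  all square matrices supported on the symmetric ones. The index type carries no order, so the
  free entries are indexed by the sets \<open>{i, j}\<close> (singletons for the diagonal) instead of by the
  pairs with \<open>i \<le> j\<close>.
\<close>

definition sym_lborel :: "(real^'n^'n) measure" where
  "sym_lborel = distr (Pi\<^sub>M {{i, j} | i j :: 'n. True} (\<lambda>_. lborel)) borel (\<lambda>f. \<chi> i j. f {i, j})"

definition multi_Gamma :: "nat \<Rightarrow> real \<Rightarrow> real" where
  "multi_Gamma l a =
     pi powr (real l * (real l - 1) / 4) * (\<Prod>j = 1..l. Gamma (a - (real j - 1) / 2))"

definition wishart_density :: "real \<Rightarrow> real^'n^'n \<Rightarrow> real^'n^'n \<Rightarrow> real" where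
  "wishart_density n \<Sigma> A =
     (if posdef_mat A
      then det A powr ((n - real CARD('n) - 1) / 2) * exp (- (1 / 2) * trace (matrix_inv \<Sigma> ** A))
           / (2 powr (real CARD('n) * n / 2) * det \<Sigma> powr (n / 2) * multi_Gamma CARD('n) (n / 2))
      else 0)"

definition wishart_distributed ::
  "'w measure \<Rightarrow> real \<Rightarrow> real^'n^'n \<Rightarrow> ('w \<Rightarrow> real^'n^'n) \<Rightarrow> bool" where
  "wishart_distributed M n \<Sigma> S \<longleftrightarrow>
     distributed M sym_lborel S (\<lambda>A. ennreal (wishart_density n \<Sigma> A))"

definition std_normal_matrix :: "'w measure \<Rightarrow> ('w \<Rightarrow> real^'m^'q) \<Rightarrow> bool" where
  "std_normal_matrix M X \<longleftrightarrow>
     prob_space.indep_vars M (\<lambda>_. borel) (\<lambda>(i, j) \<omega>. X \<omega> $ i $ j) (UNIV :: ('q \<times> 'm) set) \<and>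
     (\<forall>i j. distributed M lborel (\<lambda>\<omega>. X \<omega> $ i $ j) (\<lambda>x. ennreal (std_normal_density x)))"

text \<open>
  \<^const>\<open>prob_space.indep_var\<close> requires both random variables to have the same value type;
  independence of the generated \<open>\<sigma>\<close>-algebras is stated directly instead.
\<close>

definition indep_matrices ::
  "'w measure \<Rightarrow> ('w \<Rightarrow> real^'a^'b) \<Rightarrow> ('w \<Rightarrow> real^'c^'d) \<Rightarrow> bool" where
  "indep_matrices M S X \<longleftrightarrow>
     prob_space.indep_set M {S -` U \<inter> space M | U. U \<in> sets borel}
                            {X -` V \<inter> space M | V. V \<in> sets borel}"

definition wishart_joint_density ::
  "real \<Rightarrow> real^('a + 'b)^('a + 'b) \<Rightarrow> real^'a^'a \<Rightarrow> real^'b^'a \<Rightarrow> real^'b^'b \<Rightarrow> ennreal" where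
  "wishart_joint_density n \<Sigma> A11 A12 A22 =
     ennreal (wishart_density n \<Sigma> (block_mat A11 A12 (transpose A12) A22))"

definition wishart_diag_marginal_density ::
  "real \<Rightarrow> real^('a + 'b)^('a + 'b) \<Rightarrow> real^'a^'a \<Rightarrow> real^'b^'b \<Rightarrow> ennreal" where
  "wishart_diag_marginal_density n \<Sigma> A11 A22 =
     (\<integral>\<^sup>+ A12. wishart_joint_density n \<Sigma> A11 A12 A22 \<partial>lborel)"

definition wishart_cond_density ::
  "real \<Rightarrow> real^('a + 'b)^('a + 'b) \<Rightarrow> real^'a^'a \<Rightarrow> real^'b^'b \<Rightarrow> real^'b^'a \<Rightarrow> ennreal" where
  "wishart_cond_density n \<Sigma> A11 A22 A12 =
     wishart_joint_density n \<Sigma> A11 A12 A22 / wishart_diag_marginal_density n \<Sigma> A11 A22"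

end

theory Submission
  imports Defs
begin

text \<open>
  The pair \<open>(S, X)\<close> has a density with respect to the product of Lebesgue measures. The shear
  \<open>W = S + X X\<^sup>T\<close> preserves that measure. For fixed positive definite \<open>W\<close>, the linear map sending
  \<open>X\<close> to \<open>A\<^sub>1\<^sub>2\<close> turns \<open>det (W - X X\<^sup>T)\<close> into a Schur complement, so the density of \<open>(W, X)\<close> becomes a
  function of \<open>W\<close> times the joint Wishart density \<open>J\<close> at the given diagonal blocks. Integrating out \<open>W\<close>
  gives the law \<open>K J\<close> for \<open>A\<^sub>1\<^sub>2\<close> with a constant \<open>K\<close>, and total mass \<open>1\<close> forces \<open>K = 1 / \<integral>J\<close>. Hence
  neither the Jacobian nor the multivariate Gamma function has to be evaluated.
\<close>

text \<open>The factorization rests on three facts. The law of S, with n - l1 degrees of freedom in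
  dimension l2, and that of A, with n in dimension l1 + l2, carry the same determinant exponent (n -
  l1 - l2 - 1) / 2. The exponential weights of S and X multiply to exp (- tr W / 2), which is free
  of X. As Sigma is block diagonal, the exponential factor of J sees only the diagonal blocks. The
  square root R of W enters the Schur complement only through R R^T = W, so it may be any measurable
  one. The linear substitution acts on X alone, in a full matrix space. On symmetric matrices only
  translations and Fubini are required: for fixed X the shear translates S by the symmetric matrix X
  X^T. The equation K * \<integral>J = 1 also shows that \<integral>J is neither zero nor infinite,
  so the quotient defining the conditional density is a genuine one.\<close>

subsection \<open>Positive definite matrices\<close>

lemma posdef_mat_sym: "posdef_mat A \<Longrightarrow> transpose A = A"
  by (simp add: posdef_mat_def)

lemma posdef_mat_invertible:
  assumes "posdef_mat A"
  shows "invertible A"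
proof -
  have "A *v x = 0 \<Longrightarrow> x = 0" for x
    using assms by (metis inner_zero_right less_irrefl posdef_mat_def)
  then show ?thesis
    by (simp add: invertible_left_inverse matrix_left_invertible_ker)
qed

lemma matrix_inv_right_inverse: "invertible A \<Longrightarrow> A ** matrix_inv A = mat 1"
  for A :: "real^'n^'n"
  unfolding invertible_def matrix_inv_def by (rule someI2_ex) auto

lemma matrix_inv_left_inverse: "invertible A \<Longrightarrow> matrix_inv A ** A = mat 1"
  for A :: "real^'n^'n"
  unfolding invertible_def matrix_inv_def by (rule someI2_ex) auto

lemma matrix_inv_eqI:
  fixes A :: "real^'n^'n"
  assumes "A ** B = mat 1"
  shows "matrix_inv A = B"
proof -
  have "invertible A"
    using assms by (auto simp: invertible_right_inverse)
  then have "matrix_inv A = matrix_inv A ** (A ** B)"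
    by (simp add: assms)
  also have "\<dots> = B"
    by (simp add: matrix_mul_assoc matrix_inv_left_inverse \<open>invertible A\<close>)
  finally show ?thesis .
qed

lemma posdef_mat_congruence:
  fixes A :: "real^'n^'n" and P :: "real^'n^'n"
  assumes "invertible P" "posdef_mat A"
  shows "posdef_mat (P ** A ** transpose P)"
  unfolding posdef_mat_def
proof (intro conjI allI impI)
  show "transpose (P ** A ** transpose P) = P ** A ** transpose P"
    by (simp add: matrix_transpose_mul posdef_mat_sym[OF assms(2)] matrix_mul_assoc)
next
  fix x :: "real^'n" assume "x \<noteq> 0"
  have "invertible (transpose P)"
    using assms(1) by (simp add: invertible_det_nz)
  then have "transpose P *v x \<noteq> 0"
    using \<open>x \<noteq> 0\<close> by (metis invertible_left_inverse matrix_left_invertible_ker)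
  then have "(transpose P *v x) \<bullet> (A *v (transpose P *v x)) > 0"
    using assms(2) by (simp add: posdef_mat_def)
  then show "x \<bullet> ((P ** A ** transpose P) *v x) > 0"
    by (metis dot_lmul_matrix matrix_vector_mul_assoc transpose_matrix_vector)
qed

lemma posdef_mat_congruence_iff:
  fixes A :: "real^'n^'n" and P :: "real^'n^'n"
  assumes "invertible P"
  shows "posdef_mat (P ** A ** transpose P) \<longleftrightarrow> posdef_mat A"
proof
  let ?Q = "matrix_inv P"
  have QP: "?Q ** P = mat 1" and PQ: "P ** ?Q = mat 1"
    using assms by (simp_all add: matrix_inv_left_inverse matrix_inv_right_inverse)
  have "invertible ?Q"
    using PQ QP invertible_def by blast
  assume "posdef_mat (P ** A ** transpose P)"
  from posdef_mat_congruence[OF \<open>invertible ?Q\<close> this]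
  have "posdef_mat ((?Q ** P) ** A ** (transpose P ** transpose ?Q))"
    by (simp add: matrix_mul_assoc)
  then show "posdef_mat A"
    by (simp add: QP matrix_transpose_mul[symmetric])
qed (rule posdef_mat_congruence[OF assms])

text \<open>The quadratic form attains a positive minimum on the compact unit sphere, and
  homogeneity extends the bound to all vectors. It supplies both the contraction constant for the
  square root and the measurability of positive definiteness.\<close>

lemma posdef_mat_lower_bound:
  fixes A :: "real^'n^'n"
  assumes "posdef_mat A"
  obtains c where "c > 0" "\<And>x. c * (norm x)\<^sup>2 \<le> x \<bullet> (A *v x)"
proof -
  let ?S = "sphere (0::real^'n) 1"
  have "continuous_on ?S (\<lambda>x. x \<bullet> (A *v x))"
    by (intro continuous_intros linear_continuous_on matrix_vector_mul_bounded_linear)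
  moreover have "?S \<noteq> {}"
    by (simp add: sphere_eq_empty)
  ultimately obtain u where u: "u \<in> ?S" "\<And>y. y \<in> ?S \<Longrightarrow> u \<bullet> (A *v u) \<le> y \<bullet> (A *v y)"
    using continuous_attains_inf[of ?S "\<lambda>x. x \<bullet> (A *v x)"] by (auto simp: compact_sphere)
  show ?thesis
  proof
    show "u \<bullet> (A *v u) > 0"
      using u(1) assms by (auto simp: posdef_mat_def dest!: spec[of _ u])
    fix x :: "real^'n"
    show "(u \<bullet> (A *v u)) * (norm x)\<^sup>2 \<le> x \<bullet> (A *v x)"
    proof (cases "x = 0")
      case False
      have "u \<bullet> (A *v u) \<le> (x /\<^sub>R norm x) \<bullet> (A *v (x /\<^sub>R norm x))"
        using False by (intro u(2)) simp
      also have "\<dots> = (x \<bullet> (A *v x)) / (norm x)\<^sup>2"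
        by (simp add: matrix_vector_mult_scaleR power2_eq_square field_simps)
      finally show ?thesis
        using False by (simp add: field_simps)
    qed simp
  qed
qed

subsection \<open>The square root of a positive definite matrix\<close>

text \<open>With D = B - C one has B D + D C = B^2 - C^2 = 0. Multiplying by D and taking traces
  gives tr (D B D) + tr (D C D) = 0 with both terms nonnegative, so both vanish, and positivity of B
  forces D = 0. No diagonalization is involved.\<close>

lemma posdef_root_unique:
  fixes B C :: "real^'n^'n"
  assumes "posdef_mat B" "posdef_mat C" "B ** B = C ** C"
  shows "B = C"
proof -
  define D where "D = B - C"
  have symD: "transpose D = D"
    using assms(1,2) by (simp add: D_def posdef_mat_def transpose_def vec_eq_iff)
  have "B ** D + D ** C = B ** B - C ** C"
    by (simp add: D_def matrix_matrix_mult_def vec_eq_iff algebra_simps sum.distrib sum_subtractf)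
  then have "D ** (B ** D + D ** C) = 0"
    using assms(3) by simp
  then have "trace (D ** (B ** D + D ** C)) = 0"
    by (simp add: trace_def)
  then have "trace (D ** B ** D) + trace (D ** (D ** C)) = 0"
    by (simp only: matrix_add_ldistrib trace_add matrix_mul_assoc)
  moreover have "trace (D ** (D ** C)) = trace (D ** C ** D)"
    using trace_mul_sym[of D "D ** C"] by simp
  ultimately have "trace (D ** B ** D) + trace (D ** C ** D) = 0"
    by simp
  \<comment> \<open>As D is symmetric, the i-th diagonal entry of D E D is the quadratic form of E
    at the i-th column of D.\<close>
  have tr: "trace (D ** E ** D) = (\<Sum>i\<in>UNIV. (D *v axis i 1) \<bullet> (E *v (D *v axis i 1)))" for E
  proof -
    have "(D ** E ** D) $ i $ i = (D *v axis i 1) \<bullet> (E *v (D *v axis i 1))" for i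
    proof -
      have "(D ** E ** D) $ i $ i = axis i 1 \<bullet> ((D ** E ** D) *v axis i 1)"
        by (simp add: inner_axis' matrix_vector_mult_basis column_def)
      also have "\<dots> = (axis i 1 v* D) \<bullet> (E *v (D *v axis i 1))"
        by (simp add: dot_lmul_matrix matrix_vector_mul_assoc matrix_mul_assoc)
      also have "axis i 1 v* D = D *v axis i 1"
        by (metis symD transpose_matrix_vector)
      finally show ?thesis .
    qed
    then show ?thesis by (simp add: trace_def)
  qed
  have nn: "E = B \<or> E = C \<Longrightarrow> (D *v axis i 1) \<bullet> (E *v (D *v axis i 1)) \<ge> 0" for E i
    using assms(1,2) by (cases "D *v axis i 1 = 0") (auto simp: posdef_mat_def less_imp_le)
  have "trace (D ** E ** D) \<ge> 0" if "E = B \<or> E = C" for E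
    unfolding tr using that by (intro sum_nonneg nn)
  from this[of B] this[of C] have "trace (D ** B ** D) = 0"
    using \<open>trace (D ** B ** D) + trace (D ** C ** D) = 0\<close> by simp
  then have "(\<Sum>i\<in>UNIV. (D *v axis i 1) \<bullet> (B *v (D *v axis i 1))) = 0"
    by (simp only: tr)
  then have "(D *v axis i 1) \<bullet> (B *v (D *v axis i 1)) = 0" for i
    using nn[of B] by (simp add: sum_nonneg_eq_0_iff)
  then have "D *v axis i 1 = 0" for i
    using assms(1) unfolding posdef_mat_def by (metis less_irrefl)
  then have "D = 0"
    by (simp add: matrix_vector_mult_basis column_def vec_eq_iff)
  then show ?thesis by (simp add: D_def)
qed

text \<open>
  After scaling, \<open>A = I - B\<close> with operator norm \<open>\<parallel>B\<parallel> < 1\<close>. The map \<open>Y \<mapsto> (B + Y\<^sup>2) / 2\<close> is then a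
  contraction of a ball of operators, and its fixed point \<open>Y\<close> satisfies \<open>(I - Y)\<^sup>2 = I - B\<close>.
\<close>

lemma posdef_root_exists:
  fixes A :: "real^'n^'n"
  assumes "posdef_mat A"
  shows "\<exists>B. posdef_mat B \<and> B ** B = A"
proof -
  obtain c where c: "c > 0" "\<And>x. c * (norm x)\<^sup>2 \<le> x \<bullet> (A *v x)"
    using posdef_mat_lower_bound[OF assms] by blast
  obtain N where N: "N > 0" "\<And>x. norm (A *v x) \<le> norm x * N"
    using bounded_linear.pos_bounded[OF matrix_vector_mul_bounded_linear, of A] by auto
  \<comment> \<open>This scale minimizes 1 - 2 t c + t^2 N^2, the bound for the squared norm of I -
    t A; the minimum is 1 - c^2 / N^2.\<close>
  obtain t where t: "t = c / N\<^sup>2" "t > 0" using c N by simp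
  \<comment> \<open>The \<open>max\<close> keeps the radicand nonnegative without a comparison of
    \<open>c\<close> and \<open>N\<close>.\<close>
  define b where "b = sqrt (max 0 (1 - c\<^sup>2 / N\<^sup>2))"
  have b: "0 \<le> b" "b < 1" using c N by (auto simp: b_def)
  define L where "L = Blinfun ((*v) A)"
  have L: "blinfun_apply L x = A *v x" for x
    by (simp add: L_def bounded_linear_Blinfun_apply matrix_vector_mul_bounded_linear)
  define B where "B = id_blinfun - t *\<^sub>R L"
  have B: "blinfun_apply B x = x - t *\<^sub>R (A *v x)" for x
    by (simp add: B_def L blinfun.diff_left blinfun.scaleR_left)
  have normB: "norm B \<le> b"
  proof (rule norm_blinfun_bound)
    fix x
    have "(norm (blinfun_apply B x))\<^sup>2 = (norm x)\<^sup>2 - 2 * t * (x \<bullet> (A *v x)) + t\<^sup>2 * (norm (A *v x))\<^sup>2"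
      unfolding B by (simp only: power2_norm_eq_inner)
         (simp add: inner_diff_left inner_diff_right inner_commute power2_eq_square algebra_simps)
    also have "\<dots> \<le> (norm x)\<^sup>2 - 2 * t * (c * (norm x)\<^sup>2) + t\<^sup>2 * (norm x * N)\<^sup>2"
      using t c(2) N(2) by (intro add_mono diff_mono mult_left_mono power_mono) auto
    also have "\<dots> = (1 - c\<^sup>2 / N\<^sup>2) * (norm x)\<^sup>2"
      using N(1) by (simp add: t(1) power2_eq_square divide_simps) algebra
    also have "\<dots> \<le> (b * norm x)\<^sup>2"
      by (simp add: b_def power_mult_distrib mult_right_mono)
    finally show "norm (blinfun_apply B x) \<le> b * norm x"
      using b by (meson mult_nonneg_nonneg norm_ge_zero power2_le_imp_le)
  qed (use b in simp)
  have symA: "x \<bullet> (A *v y) = (A *v x) \<bullet> y" for x y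
    by (metis assms dot_lmul_matrix posdef_mat_sym transpose_matrix_vector)
  \<comment> \<open>Symmetry is a closed condition that \<open>F\<close> preserves, so the fixed
    point inherits it.\<close>
  define T where "T = {Y :: (real^'n) \<Rightarrow>\<^sub>L (real^'n). norm Y \<le> b \<and>
    (\<forall>x y. x \<bullet> blinfun_apply Y y = blinfun_apply Y x \<bullet> y)}"
  define F where "F Y = (1/2) *\<^sub>R (B + (Y o\<^sub>L Y))" for Y
  have "Topological_Spaces.complete T"
  proof -
    have "T = cball 0 b \<inter> (\<Inter>x. \<Inter>y. {Y. x \<bullet> blinfun_apply Y y = blinfun_apply Y x \<bullet> y})"
      by (auto simp: T_def)
    moreover have "closed \<dots>"
      by (intro closed_Int closed_cball closed_INT ballI closed_Collect_eq continuous_intros)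
    ultimately show ?thesis by (simp add: complete_eq_closed)
  qed
  moreover have "T \<noteq> {}"
    using b by (auto simp: T_def intro!: exI[of _ 0])
  moreover have "F ` T \<subseteq> T"
  proof clarify
    fix Y assume Y: "Y \<in> T"
    have "norm (F Y) \<le> (norm B + norm Y * norm Y) / 2"
      unfolding F_def using norm_triangle_ineq[of B "Y o\<^sub>L Y"] norm_blinfun_compose[of Y Y] by simp
    also have "\<dots> \<le> (b + 1 * b) / 2"
      using normB Y b by (intro divide_right_mono add_mono mult_mono) (auto simp: T_def)
    finally show "F Y \<in> T"
      using Y by (simp add: T_def F_def blinfun.add_left blinfun.scaleR_left B inner_add_left
          inner_add_right inner_diff_left inner_diff_right symA)
  qed
  moreover have "dist (F Y) (F Z) \<le> b * dist Y Z" if "Y \<in> T" "Z \<in> T" for Y Z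
  proof -
    have "F Y - F Z = (1/2) *\<^sub>R ((Y o\<^sub>L (Y - Z)) + ((Y - Z) o\<^sub>L Z))"
      by (rule blinfun_eqI)
        (simp add: F_def blinfun.add_left blinfun.diff_left blinfun.scaleR_left blinfun.diff_right
          algebra_simps)
    then have "norm (F Y - F Z) \<le> (norm Y * norm (Y - Z) + norm (Y - Z) * norm Z) / 2"
      using norm_triangle_ineq[of "Y o\<^sub>L (Y - Z)" "(Y - Z) o\<^sub>L Z"]
        norm_blinfun_compose[of Y "Y - Z"] norm_blinfun_compose[of "Y - Z" Z] by simp
    also have "\<dots> \<le> (b * norm (Y - Z) + norm (Y - Z) * b) / 2"
      using that b by (intro divide_right_mono add_mono mult_mono) (auto simp: T_def)
    finally show ?thesis by (simp add: dist_norm)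
  qed
  ultimately obtain Y where Y: "Y \<in> T" "F Y = Y"
    using Banach_fix[of T b F] b by metis
  \<comment> \<open>Since I - B = t A, dividing I - Y by \<open>sqrt t\<close> undoes the
    scaling.\<close>
  define C where "C = matrix (\<lambda>x. (1 / sqrt t) *\<^sub>R (x - blinfun_apply Y x))"
  have C: "C *v x = (1 / sqrt t) *\<^sub>R (x - blinfun_apply Y x)" for x
    unfolding C_def
    by (rule matrix_works, unfold linear_matrix_vector_mul_eq)
       (auto intro!: linearI simp: blinfun.add_right blinfun.scaleR_right algebra_simps)
  have YY: "blinfun_apply Y (blinfun_apply Y x) = 2 *\<^sub>R blinfun_apply Y x - x + t *\<^sub>R (A *v x)" for x
  proof -
    have "2 *\<^sub>R blinfun_apply (F Y) x = x - t *\<^sub>R (A *v x) + blinfun_apply Y (blinfun_apply Y x)"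
      by (simp add: F_def blinfun.add_left blinfun.scaleR_left B)
    then show ?thesis unfolding Y(2) by (simp add: algebra_simps)
  qed
  have "C *v (C *v x) = A *v x" for x
  proof -
    have "C *v (C *v x) = (1/t) *\<^sub>R (x - 2 *\<^sub>R blinfun_apply Y x + blinfun_apply Y (blinfun_apply Y x))"
      using t(2) by (simp add: C blinfun.diff_right blinfun.scaleR_right algebra_simps scaleR_2)
    then show ?thesis using t(2) by (simp add: YY)
  qed
  then have "C ** C = A"
    by (simp add: matrix_eq matrix_vector_mul_assoc)
  moreover have "posdef_mat C"
    unfolding posdef_mat_def
  proof (intro conjI allI impI)
    have "axis i 1 \<bullet> (C *v axis j 1) = (C *v axis i 1) \<bullet> axis j 1" for i j
      using Y(1) by (simp add: C T_def inner_diff_left inner_diff_right)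
    then have "C $ i $ j = C $ j $ i" for i j
      by (simp add: inner_axis inner_axis' matrix_vector_mult_basis column_def)
    then show "transpose C = C"
      by (simp add: transpose_def vec_eq_iff)
  next
    fix x :: "real^'n" assume "x \<noteq> 0"
    \<comment> \<open>Positivity of I - Y follows from the operator norm of \<open>Y\<close> being
      at most b < 1.\<close>
    have "x \<bullet> blinfun_apply Y x \<le> norm x * norm (blinfun_apply Y x)"
      by (rule norm_cauchy_schwarz)
    also have "\<dots> \<le> norm x * (norm Y * norm x)"
      by (intro mult_left_mono norm_blinfun) simp
    also have "\<dots> \<le> norm x * (b * norm x)"
      using Y(1) by (intro mult_left_mono mult_right_mono) (auto simp: T_def)
    also have "\<dots> < x \<bullet> x"
      using b \<open>x \<noteq> 0\<close> by (simp add: dot_square_norm power2_eq_square)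
    finally show "x \<bullet> (C *v x) > 0"
      using t(2) by (simp add: C inner_diff_right)
  qed
  ultimately show ?thesis by blast
qed

lemma
  assumes "posdef_mat A"
  shows posdef_mat_posdef_sqrt: "posdef_mat (posdef_sqrt A)"
    and posdef_sqrt_mult_self: "posdef_sqrt A ** posdef_sqrt A = A"
proof -
  have "\<exists>!B. posdef_mat B \<and> B ** B = A"
    using posdef_root_exists[OF assms] posdef_root_unique by metis
  from theI'[OF this, folded posdef_sqrt_def]
  show "posdef_mat (posdef_sqrt A)" "posdef_sqrt A ** posdef_sqrt A = A" by auto
qed

text \<open>The determinant is the square of the nonzero determinant of the root, which avoids
  eigenvalues and minors.\<close>

lemma det_posdef_mat_pos:
  assumes "posdef_mat A"
  shows "det A > 0"
proof -
  have "det A = (det (posdef_sqrt A))\<^sup>2"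
    using det_mul[of "posdef_sqrt A" "posdef_sqrt A"]
    by (simp add: posdef_sqrt_mult_self[OF assms] power2_eq_square)
  moreover have "det (posdef_sqrt A) \<noteq> 0"
    using posdef_mat_invertible[OF posdef_mat_posdef_sqrt[OF assms]] by (simp add: invertible_det_nz)
  ultimately show ?thesis by simp
qed

subsection \<open>Block matrices\<close>

lemma block_mat_nth [simp]:
  "block_mat A B C D $ Inl a $ Inl a' = A $ a $ a'"
  "block_mat A B C D $ Inl a $ Inr b' = B $ a $ b'"
  "block_mat A B C D $ Inr b $ Inl a' = C $ b $ a'"
  "block_mat A B C D $ Inr b $ Inr b' = D $ b $ b'"
  by (simp_all add: block_mat_def)

lemma vec_sum_type_eq_iff:
  "x = y \<longleftrightarrow> (\<forall>a. x $ Inl a = y $ Inl a) \<and> (\<forall>b. x $ Inr b = y $ Inr b)"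
  for x y :: "'c^('a::finite + 'b::finite)"
  by (auto simp: vec_eq_iff split_sum_all)

lemma sum_UNIV_sum_type:
  "(\<Sum>i\<in>UNIV. f i) = (\<Sum>a\<in>UNIV. f (Inl a)) + (\<Sum>b\<in>UNIV. f (Inr b))"
  for f :: "'a::finite + 'b::finite \<Rightarrow> real"
  by (simp add: sum.Plus flip: UNIV_Plus_UNIV)

lemma block_mat_mult:
  "block_mat A B C D ** block_mat A' B' C' D' =
    block_mat (A ** A' + B ** C') (A ** B' + B ** D') (C ** A' + D ** C') (C ** B' + D ** D')"
  by (simp add: vec_sum_type_eq_iff matrix_matrix_mult_def sum_UNIV_sum_type)

lemma transpose_zero_mat [simp]: "transpose (0 :: real^'n^'m) = 0"
  by (simp add: transpose_def vec_eq_iff)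

lemma transpose_block_mat:
  "transpose (block_mat A B C D) = block_mat (transpose A) (transpose C) (transpose B) (transpose D)"
  by (simp add: vec_sum_type_eq_iff transpose_def)

lemma trace_block_mat: "trace (block_mat A B C D) = trace A + trace D"
  by (simp add: trace_def sum_UNIV_sum_type)

lemma block_mat_one: "block_mat (mat 1) 0 0 (mat 1) = mat 1"
  by (simp add: vec_sum_type_eq_iff mat_def)

section \<open>Determinants of block matrices\<close>

lemma det_elementary_mat:
  assumes "m \<noteq> n"
  shows "det (\<chi> i j. if i = m \<and> j = n then c else of_bool (i = j) :: real^'n^'n) = 1"
proof -
  have "(\<chi> i j. if i = m \<and> j = n then c else of_bool (i = j) :: real^'n^'n) =
     (\<chi> k. if k = m then row m (mat 1) + c *s row n (mat 1) else row k (mat 1))"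
    using assms by (auto simp: vec_eq_iff row_def mat_def)
  then show ?thesis
    using det_row_operation[OF assms, of "mat 1" c] by simp
qed

lemma det_transposition_mat:
  assumes "m \<noteq> n"
  shows "det (\<chi> i j. mat 1 $ i $ Transposition.transpose m n j :: real^'n^'n) = - 1"
  using assms det_permute_columns[of "Transposition.transpose m n" "mat 1 :: real^'n^'n"]
  by (simp add: permutes_swap_id sign_swap_id)

text \<open>Padding with an identity block is multiplicative and sends each kind of elementary
  matrix to one of the same kind, so induction over elementary factors applies.\<close>

lemma det_block_mat_one:
  "det (block_mat (mat 1 :: real^'a^'a) 0 0 D) = det D" for D :: "real^'b^'b"
proof (induction D rule: induct_matrix_elementary)
  case (1 A B)
  have "block_mat (mat 1 :: real^'a^'a) 0 0 (A ** B) =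
      block_mat (mat 1) 0 0 A ** block_mat (mat 1) 0 0 B"
    by (simp add: block_mat_mult)
  then show ?case
    using 1 by (simp add: det_mul)
next
  case (2 A i)
  then have "row (Inr i) (block_mat (mat 1 :: real^'a^'a) 0 0 A) = 0"
    by (simp add: vec_sum_type_eq_iff row_def vec_eq_iff)
  then show ?case
    using 2 by (simp add: det_zero_row)
next
  case (3 A)
  have "det (block_mat (mat 1 :: real^'a^'a) 0 0 A) =
     (\<Prod>i\<in>UNIV. block_mat (mat 1 :: real^'a^'a) 0 0 A $ i $ i)"
  proof (rule det_diagonal)
    fix i j :: "'a + 'b" assume "i \<noteq> j"
    then show "block_mat (mat 1 :: real^'a^'a) 0 0 A $ i $ j = 0"
      using 3 by (cases i; cases j) (auto simp: mat_def)
  qed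
  also have "\<dots> = (\<Prod>i\<in>UNIV. A $ i $ i)"
    by (simp add: prod.Plus mat_def flip: UNIV_Plus_UNIV)
  also have "\<dots> = det A"
    using 3 by (simp add: det_diagonal)
  finally show ?case .
next
  case (4 m n)
  have "block_mat (mat 1 :: real^'a^'a) 0 0 (\<chi> i j. mat 1 $ i $ Transposition.transpose m n j) =
    (\<chi> i j. mat 1 $ i $ Transposition.transpose (Inr m) (Inr n) j)"
    using 4 by (auto simp: vec_sum_type_eq_iff mat_def Transposition.transpose_def)
  then show ?case
    using 4 by (simp add: det_transposition_mat)
next
  case (5 m n c)
  have "block_mat (mat 1 :: real^'a^'a) 0 0 (\<chi> i j. if i = m \<and> j = n then c else of_bool (i = j)) =
    (\<chi> i j. if i = Inr m \<and> j = Inr n then c else of_bool (i = j))"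
    by (auto simp: vec_sum_type_eq_iff mat_def)
  then show ?case
    using 5 by (simp add: det_elementary_mat)
qed

text \<open>The factor belonging to \<open>A\<close> stays unevaluated: it is absorbed into a
  constant, and only its positivity matters later.\<close>

lemma det_block_diag:
  "det (block_mat A 0 0 D) = det (block_mat A 0 0 (mat 1 :: real^'b^'b)) * det D"
  for A :: "real^'a^'a" and D :: "real^'b^'b"
proof -
  have "block_mat A 0 0 D = block_mat A 0 0 (mat 1) ** block_mat (mat 1) 0 0 D"
    by (simp add: block_mat_mult)
  then show ?thesis
    by (simp add: det_mul det_block_mat_one)
qed

lemma lower_unipotent_mult:
  "block_mat (mat 1 :: real^'a^'a) 0 X (mat 1 :: real^'b^'b) ** block_mat (mat 1) 0 Y (mat 1)
    = block_mat (mat 1) 0 (X + Y) (mat 1)"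
  by (simp add: block_mat_mult)

text \<open>
  Conjugating by \<open>diag(I, 2 I)\<close> turns \<open>X\<close> into \<open>2 X\<close>, so the determinant \<open>d\<close> satisfies \<open>d\<^sup>2 = d\<close>.
\<close>

lemma det_lower_unipotent:
  fixes X :: "real^'a^'b"
  shows "det (block_mat (mat 1 :: real^'a^'a) 0 X (mat 1 :: real^'b^'b)) = 1"
proof -
  let ?L = "\<lambda>X :: real^'a^'b. block_mat (mat 1 :: real^'a^'a) 0 X (mat 1 :: real^'b^'b)"
  let ?P = "block_mat (mat 1 :: real^'a^'a) 0 0 (mat 2 :: real^'b^'b)"
  \<comment> \<open>The inverse of the matrix at X is the matrix at -X, which excludes the solution
    d = 0 of d^2 = d.\<close>
  have "det (?L X) * det (?L (- X)) = det (?L (X + - X))"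
    by (simp only: lower_unipotent_mult flip: det_mul)
  then have nz: "det (?L X) \<noteq> 0"
    by (auto simp: block_mat_one)
  have mat2: "mat 2 ** X = X + X"
  proof -
    have "(mat 2 ** X) $ i $ j = (X + X) $ i $ j" for i j
      by (simp add: matrix_matrix_mult_def mat_def if_distrib if_distribR cong: if_cong)
    then show ?thesis by (simp only: vec_eq_iff) simp
  qed
  have "?P ** ?L X = ?L (X + X) ** ?P"
    by (simp only: block_mat_mult mat2) simp
  then have "det ?P * det (?L X) = det (?L (X + X)) * det ?P"
    by (simp flip: det_mul)
  moreover have "det ?P \<noteq> 0"
    unfolding det_block_mat_one by (simp add: det_diagonal mat_def)
  moreover have "det (?L (X + X)) = det (?L X) * det (?L X)"
    by (simp only: lower_unipotent_mult flip: det_mul)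
  ultimately show ?thesis
    using nz by simp
qed

section \<open>Schur complements\<close>

lemma posdef_block_diag_iff:
  "posdef_mat (block_mat A 0 0 D) \<longleftrightarrow> posdef_mat A \<and> posdef_mat D"
  for A :: "real^'a^'a" and D :: "real^'b^'b"
proof -
  define in1 :: "real^'a \<Rightarrow> real^'b \<Rightarrow> real^('a+'b)"
    where "in1 = (\<lambda>u v. \<chi> i. case i of Inl a \<Rightarrow> u $ a | Inr b \<Rightarrow> v $ b)"
  have q: "in1 u v \<bullet> (block_mat A 0 0 D *v in1 u v) = u \<bullet> (A *v u) + v \<bullet> (D *v v)" for u v
    by (simp add: inner_vec_def sum_UNIV_sum_type in1_def matrix_vector_mult_def)
  have surj: "\<exists>u v. x = in1 u v" for x
    by (rule exI[of _ "\<chi> a. x $ Inl a"], rule exI[of _ "\<chi> b. x $ Inr b"])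
       (simp add: in1_def vec_sum_type_eq_iff)
  have zero: "in1 u v = 0 \<longleftrightarrow> u = 0 \<and> v = 0" for u v
    by (simp add: in1_def vec_sum_type_eq_iff vec_eq_iff)
  have sym: "transpose (block_mat A 0 0 D) = block_mat A 0 0 D \<longleftrightarrow> transpose A = A \<and> transpose D = D"
    by (simp add: transpose_block_mat vec_sum_type_eq_iff)
       (simp add: vec_eq_iff transpose_def)
  have "(\<forall>x. x \<noteq> 0 \<longrightarrow> x \<bullet> (block_mat A 0 0 D *v x) > 0) \<longleftrightarrow>
    (\<forall>u v. \<not> (u = 0 \<and> v = 0) \<longrightarrow> u \<bullet> (A *v u) + v \<bullet> (D *v v) > 0)"
    by (metis q surj zero)
  also have "\<dots> \<longleftrightarrow> (\<forall>u. u \<noteq> 0 \<longrightarrow> u \<bullet> (A *v u) > 0) \<and> (\<forall>v. v \<noteq> 0 \<longrightarrow> v \<bullet> (D *v v) > 0)"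
  proof (rule iffI; (intro conjI allI impI)?)
    fix u :: "real^'a" assume "\<forall>(u::real^'a) (v::real^'b). \<not> (u = 0 \<and> v = 0) \<longrightarrow> u \<bullet> (A *v u) + v \<bullet> (D *v v) > 0" "u \<noteq> 0"
    then have "u \<bullet> (A *v u) + 0 \<bullet> (D *v 0) > 0" by blast
    then show "u \<bullet> (A *v u) > 0" by simp
  next
    fix v :: "real^'b" assume "\<forall>(u::real^'a) (v::real^'b). \<not> (u = 0 \<and> v = 0) \<longrightarrow> u \<bullet> (A *v u) + v \<bullet> (D *v v) > 0" "v \<noteq> 0"
    then have "0 \<bullet> (A *v 0) + v \<bullet> (D *v v) > 0" by blast
    then show "v \<bullet> (D *v v) > 0" by simp
  next
    fix u :: "real^'a" and v :: "real^'b" assume "(\<forall>u. u \<noteq> 0 \<longrightarrow> u \<bullet> (A *v u) > 0) \<and> (\<forall>v. v \<noteq> 0 \<longrightarrow> v \<bullet> (D *v v) > 0)"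
      "\<not> (u = 0 \<and> v = 0)"
    then show "u \<bullet> (A *v u) + v \<bullet> (D *v v) > 0"
      by (cases "u = 0"; cases "v = 0") (auto intro: add_pos_pos)
  qed
  finally show ?thesis
    by (auto simp: posdef_mat_def sym)
qed

text \<open>Block Gaussian elimination. The factor \<open>L\<close> is unipotent, so the congruence
  preserves positive definiteness and the determinant, and both reduce to the block diagonal
  case.\<close>

lemma block_mat_schur:
  fixes A :: "real^'a^'a" and D :: "real^'b^'b" and B :: "real^'b^'a"
  assumes "posdef_mat A"
  defines "L \<equiv> block_mat (mat 1) 0 (transpose B ** matrix_inv A) (mat 1 :: real^'b^'b)"
  shows "block_mat A B (transpose B) D =
      L ** block_mat A 0 0 (D - transpose B ** matrix_inv A ** B) ** transpose L"
proof -
  have inv: "A ** matrix_inv A = mat 1" "matrix_inv A ** A = mat 1"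
    by (simp_all add: matrix_inv_right_inverse matrix_inv_left_inverse posdef_mat_invertible assms(1))
  have "transpose (matrix_inv A) = matrix_inv A"
    by (metis assms(1) inv(2) matrix_inv_eqI matrix_transpose_mul posdef_mat_sym transpose_mat)
  then have "transpose (transpose B ** matrix_inv A) = matrix_inv A ** B"
    by (simp add: matrix_transpose_mul)
  then show ?thesis
    by (simp add: L_def block_mat_mult transpose_block_mat matrix_mul_assoc inv
         flip: matrix_mul_assoc[of _ "matrix_inv A" A] matrix_mul_assoc[of _ A "matrix_inv A"])
qed

lemma
  fixes A :: "real^'a^'a" and D :: "real^'b^'b" and B :: "real^'b^'a"
  assumes "posdef_mat A"
  shows posdef_block_iff_schur: "posdef_mat (block_mat A B (transpose B) D) \<longleftrightarrow>
      posdef_mat (D - transpose B ** matrix_inv A ** B)" (is ?th1)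
    and det_block_schur: "det (block_mat A B (transpose B) D) =
      det (block_mat A 0 0 (mat 1 :: real^'b^'b)) * det (D - transpose B ** matrix_inv A ** B)" (is ?th2)
proof -
  let ?L = "block_mat (mat 1) 0 (transpose B ** matrix_inv A) (mat 1 :: real^'b^'b)"
  have "invertible ?L"
    by (simp add: invertible_det_nz det_lower_unipotent)
  then show ?th1
    unfolding block_mat_schur[OF assms]
    by (simp add: posdef_mat_congruence_iff posdef_block_diag_iff assms)
  show ?th2
    unfolding block_mat_schur[OF assms]
    by (simp add: det_mul det_lower_unipotent det_block_diag[of A "D - transpose B ** matrix_inv A ** B"])
qed

lemma matrix_inv_block_diag:
  assumes "invertible A" "invertible D"
  shows "matrix_inv (block_mat A 0 0 D) = block_mat (matrix_inv A) 0 0 (matrix_inv D)"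
  by (rule matrix_inv_eqI) (simp add: block_mat_mult matrix_inv_right_inverse assms block_mat_one)

subsection \<open>Measurability of matrix operations\<close>

lemma measurable_vec_nth [measurable]: "(\<lambda>x. x $ i) \<in> borel_measurable borel"
  for i :: "'n::finite"
  by (intro borel_measurable_continuous_onI continuous_intros)

lemma borel_measurable_vecI:
  fixes f :: "'x \<Rightarrow> 'a::euclidean_space^'n"
  assumes "\<And>i. (\<lambda>x. f x $ i) \<in> borel_measurable M"
  shows "f \<in> borel_measurable M"
proof (rule borel_measurable_euclidean_space[THEN iffD2], rule ballI)
  fix b :: "'a^'n" assume "b \<in> Basis"
  then obtain i u where "b = axis i u" by (auto simp: Basis_vec_def)
  then show "(\<lambda>x. f x \<bullet> b) \<in> borel_measurable M"
    using assms by (simp add: inner_axis borel_measurable_inner)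
qed

lemma borel_measurable_matrixI:
  fixes f :: "'x \<Rightarrow> real^'n^'m"
  assumes "\<And>i j. (\<lambda>x. f x $ i $ j) \<in> borel_measurable M"
  shows "f \<in> borel_measurable M"
  by (rule borel_measurable_vecI, rule borel_measurable_vecI, rule assms)

lemma borel_measurable_matrix_mult [measurable (raw)]:
  fixes f :: "'x \<Rightarrow> real^'n^'m" and g :: "'x \<Rightarrow> real^'k^'n"
  assumes [measurable]: "f \<in> borel_measurable M" "g \<in> borel_measurable M"
  shows "(\<lambda>x. f x ** g x) \<in> borel_measurable M"
  by (rule borel_measurable_matrixI) (simp add: matrix_matrix_mult_def, measurable)

lemma borel_measurable_transpose [measurable (raw)]:
  fixes f :: "'x \<Rightarrow> real^'n^'m"
  assumes [measurable]: "f \<in> borel_measurable M"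
  shows "(\<lambda>x. transpose (f x)) \<in> borel_measurable M"
  by (rule borel_measurable_matrixI) (simp add: transpose_def, measurable)

lemma borel_measurable_trace [measurable (raw)]:
  fixes f :: "'x \<Rightarrow> real^'n^'n"
  assumes [measurable]: "f \<in> borel_measurable M"
  shows "(\<lambda>x. trace (f x)) \<in> borel_measurable M"
  unfolding trace_def by measurable

lemma borel_measurable_det [measurable (raw)]:
  fixes f :: "'x \<Rightarrow> real^'n^'n"
  assumes [measurable]: "f \<in> borel_measurable M"
  shows "(\<lambda>x. det (f x)) \<in> borel_measurable M"
  unfolding det_def by measurable

lemma borel_measurable_block_mat [measurable (raw)]:
  assumes [measurable]: "A \<in> borel_measurable M" "B \<in> borel_measurable M"
    "C \<in> borel_measurable M" "D \<in> borel_measurable M"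
  shows "(\<lambda>x. block_mat (A x) (B x) (C x) (D x)) \<in> borel_measurable M"
proof (rule borel_measurable_matrixI)
  fix i j
  show "(\<lambda>x. block_mat (A x) (B x) (C x) (D x) $ i $ j) \<in> borel_measurable M"
    by (cases i; cases j) (simp_all add: block_mat_def)
qed

text \<open>On singular matrices \<^const>\<open>matrix_inv\<close> is a choice from an empty set, hence constant.\<close>

lemma borel_measurable_matrix_inv [measurable (raw)]:
  fixes f :: "'x \<Rightarrow> real^'n^'n"
  assumes [measurable]: "f \<in> borel_measurable M"
  shows "(\<lambda>x. matrix_inv (f x)) \<in> borel_measurable M"
proof -
  define c :: "real^'n^'n" where "c = (SOME A. False)"
  \<comment> \<open>The adjugate in the form given by Cramer's rule: entry (k, l) replaces column k
    of \<open>A\<close> by the l-th unit vector.\<close>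
  define adj :: "real^'n^'n \<Rightarrow> real^'n^'n" where
    "adj A = (\<chi> k l. det (\<chi> i j. if j = k then axis l 1 $ i else A $ i $ j))" for A
  have "matrix_inv A = (if det A = 0 then c else (1 / det A) *\<^sub>R adj A)" for A :: "real^'n^'n"
  proof (cases "det A = 0")
    case True
    then have "\<not> invertible A" by (simp add: invertible_det_nz)
    then have "(\<lambda>B. A ** B = mat 1 \<and> B ** A = mat 1) = (\<lambda>B. False)"
      unfolding invertible_def by auto
    then have "matrix_inv A = c"
      unfolding matrix_inv_def c_def by (rule arg_cong)
    then show ?thesis using True by simp
  next
    case False
    then have "invertible A" by (simp add: invertible_det_nz)
    then have "A ** matrix_inv A = mat 1"
      by (rule matrix_inv_right_inverse)
    then have "A *v (matrix_inv A *v axis l 1) = axis l 1" for l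
      by (simp add: matrix_vector_mul_assoc)
    then have "matrix_inv A *v axis l 1 = (\<chi> k. det (\<chi> i j. if j = k then axis l 1 $ i else A $ i $ j) / det A)" for l
      using cramer[OF False, of "matrix_inv A *v axis l 1" "axis l 1"] by simp
    then have "matrix_inv A $ k $ l = adj A $ k $ l / det A" for k l
      by (simp add: adj_def matrix_vector_mult_basis column_def vec_eq_iff)
    then show ?thesis
      using False by (simp add: vec_eq_iff)
  qed
  moreover have "(\<lambda>x. adj (f x)) \<in> borel_measurable M"
    unfolding adj_def
    by (intro borel_measurable_matrixI, simp, intro borel_measurable_det borel_measurable_matrixI) simp
  ultimately show ?thesis by simp
qed

text \<open>By the uniform lower bound, the positive definite matrices are the symmetric ones in a
  countable union of the sets \<open>Q k\<close>. Each \<open>Q k\<close> is closed although it is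
  an intersection over uncountably many vectors.\<close>

lemma measurable_posdef_mat [measurable]: "Measurable.pred borel (posdef_mat :: real^'n^'n \<Rightarrow> bool)"
proof -
  define Q :: "nat \<Rightarrow> (real^'n^'n) set" where
    "Q k = (\<Inter>x. {A. inverse (real (Suc k)) * (norm x)\<^sup>2 \<le> x \<bullet> (A *v x)})" for k
  have "closed (Q k)" for k
    unfolding Q_def matrix_vector_mult_def inner_vec_def
    by (intro closed_INT ballI closed_Collect_le continuous_intros)
  then have [measurable]: "Q k \<in> sets borel" for k
    by (rule borel_closed)
  have "posdef_mat A \<longleftrightarrow> transpose A = A \<and> (\<exists>k. A \<in> Q k)" for A :: "real^'n^'n"
  proof safe
    assume "posdef_mat A"
    then obtain c where c: "c > 0" "\<And>x. c * (norm x)\<^sup>2 \<le> x \<bullet> (A *v x)"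
      using posdef_mat_lower_bound by blast
    obtain k where "inverse (real (Suc k)) < c"
      using reals_Archimedean[OF c(1)] by blast
    then have "inverse (real (Suc k)) * (norm x)\<^sup>2 \<le> c * (norm x)\<^sup>2" for x :: "real^'n"
      by (intro mult_right_mono) auto
    then have "A \<in> Q k"
      unfolding Q_def using c(2) by (auto intro: order_trans)
    then show "\<exists>k. A \<in> Q k" ..
  next
    fix k assume "transpose A = A" "A \<in> Q k"
    moreover have "0 < inverse (real (Suc k)) * (norm x)\<^sup>2" if "x \<noteq> 0" for x :: "real^'n"
      using that by simp
    ultimately show "posdef_mat A"
      unfolding posdef_mat_def Q_def by (blast intro: less_le_trans)
  qed (simp add: posdef_mat_def)
  then show ?thesis by (simp add: pred_def)
qed

subsection \<open>Linear changes of variables\<close>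

lemma nn_integral_lborel_translate:
  fixes g :: "'a::euclidean_space \<Rightarrow> ennreal"
  assumes [measurable]: "g \<in> borel_measurable borel"
  shows "(\<integral>\<^sup>+x. g (x + t) \<partial>lborel) = (\<integral>\<^sup>+x. g x \<partial>lborel)"
proof -
  have "(\<integral>\<^sup>+x. g x \<partial>distr lborel borel ((+) t)) = (\<integral>\<^sup>+x. g (t + x) \<partial>lborel)"
    by (rule nn_integral_distr) measurable
  then show ?thesis
    by (simp add: lborel_distr_plus add.commute)
qed

text \<open>
  Uniqueness of Haar measure: \<open>\<integral>f \<cdot> \<integral>g \<circ> T\<close> is computed twice from the double integral of
  \<open>f x * g (x + T y)\<close>. The Jacobian of \<open>T\<close> appears as the integral on the right, whose dependence
  on \<open>T\<close> is visibly measurable; its value never matters.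
\<close>

lemma nn_integral_lborel_linear:
  fixes T :: "'a::euclidean_space \<Rightarrow> 'b::euclidean_space" and f g :: "'b \<Rightarrow> ennreal"
  assumes T: "linear T" "\<And>x. T (T' x) = x"
    and [measurable]: "f \<in> borel_measurable borel" "g \<in> borel_measurable borel"
    and f: "(\<integral>\<^sup>+x. f x \<partial>lborel) = 1"
  shows "(\<integral>\<^sup>+y. g (T y) \<partial>lborel) = (\<integral>\<^sup>+y. f (- T y) \<partial>lborel) * (\<integral>\<^sup>+x. g x \<partial>lborel)"
proof -
  have [measurable]: "T \<in> borel_measurable borel"
    using T(1) by (intro borel_measurable_continuous_onI linear_continuous_on) (simp add: linear_linear)
  have "(\<integral>\<^sup>+y. g (T y) \<partial>lborel) = (\<integral>\<^sup>+x. f x * (\<integral>\<^sup>+y. g (T y) \<partial>lborel) \<partial>lborel)"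
    by (simp add: nn_integral_multc f)
  also have "\<dots> = (\<integral>\<^sup>+x. (\<integral>\<^sup>+y. f x * g (x + T y) \<partial>lborel) \<partial>lborel)"
  proof (rule nn_integral_cong)
    fix x
    \<comment> \<open>The right inverse turns a shift by \<open>x\<close> in the target into a shift
      by \<open>T' x\<close> in the source.\<close>
    have "(\<integral>\<^sup>+y. g (T y) \<partial>lborel) = (\<integral>\<^sup>+y. g (T (y + T' x)) \<partial>lborel)"
      by (rule nn_integral_lborel_translate[symmetric]) measurable
    then show "f x * (\<integral>\<^sup>+y. g (T y) \<partial>lborel) = (\<integral>\<^sup>+y. f x * g (x + T y) \<partial>lborel)"
      by (simp add: nn_integral_cmult linear_add[OF T(1)] T(2) add.commute)
  qed
  also have "\<dots> = (\<integral>\<^sup>+y. (\<integral>\<^sup>+x. f x * g (x + T y) \<partial>lborel) \<partial>lborel)"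
    by (rule lborel_pair.Fubini'[symmetric]) measurable
  also have "\<dots> = (\<integral>\<^sup>+y. (\<integral>\<^sup>+x. f (x - T y) * g x \<partial>lborel) \<partial>lborel)"
  proof (rule nn_integral_cong)
    fix y
    have "(\<integral>\<^sup>+x. f (x + T y - T y) * g (x + T y) \<partial>lborel) = (\<integral>\<^sup>+x. f (x - T y) * g x \<partial>lborel)"
      by (rule nn_integral_lborel_translate[where g="\<lambda>x. f (x - T y) * g x"]) measurable
    then show "(\<integral>\<^sup>+x. f x * g (x + T y) \<partial>lborel) = (\<integral>\<^sup>+x. f (x - T y) * g x \<partial>lborel)"
      by simp
  qed
  also have "\<dots> = (\<integral>\<^sup>+x. (\<integral>\<^sup>+y. f (x - T y) * g x \<partial>lborel) \<partial>lborel)"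
    by (rule lborel_pair.Fubini') measurable
  also have "\<dots> = (\<integral>\<^sup>+x. (\<integral>\<^sup>+y. f (- T y) \<partial>lborel) * g x \<partial>lborel)"
  proof (rule nn_integral_cong)
    fix x
    have "(\<integral>\<^sup>+y. f (x - T y) \<partial>lborel) = (\<integral>\<^sup>+y. f (x - T (y + T' x)) \<partial>lborel)"
      by (rule nn_integral_lborel_translate[symmetric]) measurable
    then show "(\<integral>\<^sup>+y. f (x - T y) * g x \<partial>lborel) = (\<integral>\<^sup>+y. f (- T y) \<partial>lborel) * g x"
      by (simp add: nn_integral_multc linear_add[OF T(1)] T(2))
  qed
  finally show ?thesis
    by (simp add: nn_integral_cmult)
qed

subsection \<open>Lebesgue measure on symmetric matrices\<close>

lemma sets_sym_lborel [simp, measurable_cong]: "sets sym_lborel = sets borel"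
  by (simp add: sym_lborel_def)

abbreviation edge_sets :: "'n set set" where
  "edge_sets \<equiv> {{i, j} | i j :: 'n. True}"

lemma finite_edge_sets: "finite (edge_sets :: 'n::finite set set)"
  by simp

lemma measurable_sym_of_entries [measurable]:
  "(\<lambda>f. \<chi> i j :: 'n::finite. f {i, j}) \<in> borel_measurable (Pi\<^sub>M edge_sets (\<lambda>_. lborel :: real measure))"
proof (rule borel_measurable_matrixI)
  fix i j :: 'n
  have "(\<lambda>f. f {i, j}) \<in> measurable (Pi\<^sub>M edge_sets (\<lambda>_. lborel :: real measure)) lborel"
    by (rule measurable_component_singleton) auto
  then show "(\<lambda>f. (\<chi> i j. f {i, j}) $ i $ j) \<in> borel_measurable (Pi\<^sub>M edge_sets (\<lambda>_. lborel :: real measure))"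
    by simp
qed

lemma nn_integral_sym_lborel:
  fixes g :: "real^'n^'n \<Rightarrow> ennreal"
  assumes "g \<in> borel_measurable borel"
  shows "(\<integral>\<^sup>+A. g A \<partial>sym_lborel) = (\<integral>\<^sup>+f. g (\<chi> i j. f {i, j}) \<partial>Pi\<^sub>M edge_sets (\<lambda>_. lborel))"
  unfolding sym_lborel_def by (rule nn_integral_distr[OF measurable_sym_of_entries]) (simp add: assms)

interpretation lborel_product: product_sigma_finite "\<lambda>_. lborel :: real measure" ..

text \<open>Boxes determine the product measure, and on a box the translation acts coordinatewise.
  The restriction to \<open>I\<close> keeps the translated function in the extensional function
  space.\<close>

lemma distr_PiM_lborel_translate:
  fixes t :: "'i \<Rightarrow> real"
  assumes "finite I"
  shows "distr (Pi\<^sub>M I (\<lambda>_. lborel)) (Pi\<^sub>M I (\<lambda>_. lborel)) (\<lambda>f. \<lambda>i\<in>I. f i + t i) = Pi\<^sub>M I (\<lambda>_. lborel)"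
    (is "?D = _")
proof (rule lborel_product.PiM_eqI[OF assms])
  fix A :: "'i \<Rightarrow> real set" assume A: "\<And>i. i \<in> I \<Longrightarrow> A i \<in> sets lborel"
  have "Pi\<^sub>E I A \<in> sets (Pi\<^sub>M I (\<lambda>_. lborel))"
    using A assms by (intro sets_PiM_I_finite)
  moreover have "(\<lambda>f. \<lambda>i\<in>I. f i + t i) -` Pi\<^sub>E I A \<inter> space (Pi\<^sub>M I (\<lambda>_. lborel)) =
      Pi\<^sub>E I (\<lambda>i. (\<lambda>x. x + t i) -` A i)"
    by (auto simp: space_PiM PiE_iff)
  moreover have "(\<lambda>f. \<lambda>i\<in>I. f i + t i) \<in> measurable (Pi\<^sub>M I (\<lambda>_. lborel)) (Pi\<^sub>M I (\<lambda>_. lborel))"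
    by measurable
  ultimately have "emeasure ?D (Pi\<^sub>E I A) = emeasure (Pi\<^sub>M I (\<lambda>_. lborel)) (Pi\<^sub>E I (\<lambda>i. (\<lambda>x. x + t i) -` A i))"
    by (simp add: emeasure_distr)
  also have "\<dots> = (\<Prod>i\<in>I. emeasure lborel ((\<lambda>x. x + t i) -` A i))"
  proof (rule lborel_product.emeasure_PiM[OF assms])
    fix i assume "i \<in> I"
    then have [measurable]: "A i \<in> sets borel" using A by auto
    have "(\<lambda>x. x + t i) -` A i \<inter> space borel \<in> sets borel"
      by measurable
    then show "(\<lambda>x. x + t i) -` A i \<in> sets lborel" by simp
  qed
  also have "\<dots> = (\<Prod>i\<in>I. emeasure lborel (A i))"
  proof (rule prod.cong)
    fix i assume "i \<in> I"
    then have "A i \<in> sets borel" using A by auto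
    then have "emeasure (distr lborel borel ((+) (t i))) (A i) = emeasure lborel ((\<lambda>x. x + t i) -` A i)"
      by (subst emeasure_distr) (auto simp: add.commute vimage_def)
    then show "emeasure lborel ((\<lambda>x. x + t i) -` A i) = emeasure lborel (A i)"
      by (simp add: lborel_distr_plus)
  qed simp
  finally show "emeasure ?D (Pi\<^sub>E I A) = (\<Prod>i\<in>I. emeasure lborel (A i))" .
qed simp

lemma nn_integral_sym_lborel_translate:
  fixes g :: "real^'n^'n \<Rightarrow> ennreal"
  assumes [measurable]: "g \<in> borel_measurable borel" and sym: "transpose T = T"
  shows "(\<integral>\<^sup>+A. g (A + T) \<partial>sym_lborel) = (\<integral>\<^sup>+A. g A \<partial>sym_lborel)"
proof -
  let ?P = "Pi\<^sub>M (edge_sets :: 'n set set) (\<lambda>_. lborel :: real measure)"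
  \<comment> \<open>The entry of \<open>T\<close> at an unordered pair; the description is
    unambiguous because \<open>T\<close> is symmetric.\<close>
  define t where "t s = (THE c. \<exists>i j. s = {i, j} \<and> c = T $ i $ j)" for s
  have sym': "T $ i $ j = T $ j $ i" for i j
    using sym by (metis transpose_def vec_lambda_beta)
  have t: "t {i, j} = T $ i $ j" for i j
    unfolding t_def by (rule the_equality) (auto simp: doubleton_eq_iff sym')
  have "(\<integral>\<^sup>+A. g A \<partial>sym_lborel) = (\<integral>\<^sup>+f. g (\<chi> i j. f {i, j}) \<partial>distr ?P ?P (\<lambda>f. \<lambda>s\<in>edge_sets. f s + t s))"
    by (simp add: nn_integral_sym_lborel distr_PiM_lborel_translate finite_edge_sets)
  also have "\<dots> = (\<integral>\<^sup>+f. g (\<chi> i j. (\<lambda>s\<in>edge_sets. f s + t s) {i, j}) \<partial>?P)"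
    by (rule nn_integral_distr) measurable
  also have "\<dots> = (\<integral>\<^sup>+f. g ((\<chi> i j. f {i, j}) + T) \<partial>?P)"
  proof (rule nn_integral_cong)
    fix f :: "'n set \<Rightarrow> real"
    have "{i, j} \<in> edge_sets" for i j :: 'n by auto
    then have "(\<chi> i j. (\<lambda>s\<in>edge_sets. f s + t s) {i, j}) = (\<chi> i j. f {i, j}) + T"
      by (simp add: vec_eq_iff t)
    then show "g (\<chi> i j. (\<lambda>s\<in>edge_sets. f s + t s) {i, j}) = g ((\<chi> i j. f {i, j}) + T)" by simp
  qed
  also have "\<dots> = (\<integral>\<^sup>+A. g (A + T) \<partial>sym_lborel)"
    by (subst nn_integral_sym_lborel) auto
  finally show ?thesis by simp
qed

text \<open>The exchange takes place on the product measure over the free entries, where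
  sigma-finiteness is at hand; \<open>sym_lborel\<close> is its image.\<close>

lemma sym_lborel_Fubini:
  fixes g :: "(real^'n^'n) \<times> 'a::euclidean_space \<Rightarrow> ennreal"
  assumes [measurable]: "g \<in> borel_measurable (borel \<Otimes>\<^sub>M borel)"
  shows "(\<integral>\<^sup>+A. (\<integral>\<^sup>+x. g (A, x) \<partial>lborel) \<partial>sym_lborel) = (\<integral>\<^sup>+x. (\<integral>\<^sup>+A. g (A, x) \<partial>sym_lborel) \<partial>lborel)"
proof -
  let ?P = "Pi\<^sub>M (edge_sets :: 'n set set) (\<lambda>_. lborel :: real measure)"
  interpret P: sigma_finite_measure ?P
    by (rule lborel_product.sigma_finite[OF finite_edge_sets])
  interpret pair_sigma_finite ?P "lborel :: 'a measure" ..
  have "(\<integral>\<^sup>+A. (\<integral>\<^sup>+x. g (A, x) \<partial>lborel) \<partial>sym_lborel) = (\<integral>\<^sup>+f. (\<integral>\<^sup>+x. g (\<chi> i j. f {i, j}, x) \<partial>lborel) \<partial>?P)"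
    by (rule nn_integral_sym_lborel) measurable
  also have "\<dots> = (\<integral>\<^sup>+x. (\<integral>\<^sup>+f. g (\<chi> i j. f {i, j}, x) \<partial>?P) \<partial>lborel)"
    by (rule Fubini'[symmetric]) measurable
  also have "\<dots> = (\<integral>\<^sup>+x. (\<integral>\<^sup>+A. g (A, x) \<partial>sym_lborel) \<partial>lborel)"
    by (simp add: nn_integral_sym_lborel)
  finally show ?thesis .
qed

text \<open>Once Fubini makes the symmetric variable the inner one, the shear at fixed
  \<open>x\<close> is a translation by a symmetric matrix.\<close>

lemma sym_lborel_shear:
  fixes g :: "(real^'n^'n) \<times> 'a::euclidean_space \<Rightarrow> ennreal" and T :: "'a \<Rightarrow> real^'n^'n"
  assumes [measurable]: "g \<in> borel_measurable (borel \<Otimes>\<^sub>M borel)" "T \<in> borel_measurable borel"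
    and sym: "\<And>x. transpose (T x) = T x"
  shows "(\<integral>\<^sup>+A. (\<integral>\<^sup>+x. g (A, x) \<partial>lborel) \<partial>sym_lborel) = (\<integral>\<^sup>+A. (\<integral>\<^sup>+x. g (A - T x, x) \<partial>lborel) \<partial>sym_lborel)"
proof -
  have "(\<integral>\<^sup>+A. (\<integral>\<^sup>+x. g (A - T x, x) \<partial>lborel) \<partial>sym_lborel) = (\<integral>\<^sup>+x. (\<integral>\<^sup>+A. g (A - T x, x) \<partial>sym_lborel) \<partial>lborel)"
    by (rule sym_lborel_Fubini[where g="\<lambda>(A, x). g (A - T x, x)", simplified]) measurable
  also have "\<dots> = (\<integral>\<^sup>+x. (\<integral>\<^sup>+A. g (A, x) \<partial>sym_lborel) \<partial>lborel)"
  proof (rule nn_integral_cong)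
    fix x
    have "transpose (- T x) = - T x"
      using sym[of x] by (simp add: transpose_def vec_eq_iff)
    then have "(\<integral>\<^sup>+A. g (A + - T x, x) \<partial>sym_lborel) = (\<integral>\<^sup>+A. g (A, x) \<partial>sym_lborel)"
      by (intro nn_integral_sym_lborel_translate[where g="\<lambda>A. g (A, x)"]) measurable
    then show "(\<integral>\<^sup>+A. g (A - T x, x) \<partial>sym_lborel) = (\<integral>\<^sup>+A. g (A, x) \<partial>sym_lborel)"
      by simp
  qed
  also have "\<dots> = (\<integral>\<^sup>+A. (\<integral>\<^sup>+x. g (A, x) \<partial>lborel) \<partial>sym_lborel)"
    by (rule sym_lborel_Fubini[symmetric]) fact
  finally show ?thesis by simp
qed

subsection \<open>The normal matrix and joint distributions\<close>

text \<open>Volumes of boxes characterize Lebesgue measure, and the basis vectors are the matrix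
  units. This carries the product density of independent entries over to the matrix space.\<close>

lemma lborel_matrix_eq_distr:
  "lborel = distr (Pi\<^sub>M (UNIV :: ('q::finite \<times> 'm::finite) set) (\<lambda>_. lborel)) borel
     (\<lambda>f. \<chi> i j. f (i, j) :: real^'m^'q)" (is "_ = ?D")
proof (rule lborel_eqI)
  let ?P = "Pi\<^sub>M (UNIV :: ('q \<times> 'm) set) (\<lambda>_. lborel :: real measure)"
  let ?v = "\<lambda>f. \<chi> i j. f (i, j) :: real^'m^'q"
  have [measurable]: "?v \<in> borel_measurable ?P"
    by (rule borel_measurable_matrixI) simp
  fix l u :: "real^'m^'q" assume le: "\<And>b. b \<in> Basis \<Longrightarrow> l \<bullet> b \<le> u \<bullet> b"
  have basis: "axis i (axis j 1) \<in> (Basis :: (real^'m^'q) set)" for i j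
    by (auto simp: Basis_vec_def)
  have le': "l $ i $ j \<le> u $ i $ j" for i j
    using le[OF basis, of i j] by (simp add: inner_axis)
  have box: "x \<in> box l u \<longleftrightarrow> (\<forall>i j. l $ i $ j < x $ i $ j \<and> x $ i $ j < u $ i $ j)" for x
    by (auto simp: mem_box Basis_vec_def inner_axis)
  have "?v -` box l u \<inter> space ?P = Pi\<^sub>E UNIV (\<lambda>(i, j). {l $ i $ j <..< u $ i $ j})"
    by (auto simp: space_PiM box PiE_iff)
  then have "emeasure ?D (box l u) = emeasure ?P (Pi\<^sub>E UNIV (\<lambda>(i, j). {l $ i $ j <..< u $ i $ j}))"
    by (subst emeasure_distr) auto
  also have "\<dots> = (\<Prod>(i, j)\<in>UNIV. emeasure lborel {l $ i $ j <..< u $ i $ j})"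
    by (subst lborel_product.emeasure_PiM) (auto simp: case_prod_unfold)
  also have "\<dots> = (\<Prod>(i, j)\<in>UNIV. ennreal (u $ i $ j - l $ i $ j))"
    using le' by (simp add: case_prod_unfold)
  also have "\<dots> = ennreal (\<Prod>(i, j)\<in>UNIV. u $ i $ j - l $ i $ j)"
    using le' by (subst prod_ennreal[symmetric]) (auto simp: case_prod_unfold)
  also have "(\<Prod>(i, j)\<in>UNIV. u $ i $ j - l $ i $ j) = (\<Prod>b\<in>Basis. (u - l) \<bullet> b)"
  proof -
    have "bij_betw (\<lambda>p. axis (fst p) (axis (snd p) 1)) UNIV (Basis :: (real^'m^'q) set)"
      by (auto simp: bij_betw_def inj_on_def Basis_vec_def axis_eq_axis image_iff)
    from prod.reindex_bij_betw[OF this, of "(\<bullet>) (u - l)"] show ?thesis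
      by (simp add: inner_axis case_prod_unfold)
  qed
  finally show "emeasure ?D (box l u) = ennreal (\<Prod>b\<in>Basis. (u - l) \<bullet> b)" .
qed simp

text \<open>By independence the density is the product of the entry densities, whose exponents add
  up to the sum of squares tr (x x^T). The trace form is chosen so as to combine with the trace in
  the density of S.\<close>

lemma distributed_std_normal_matrix:
  fixes X :: "'w \<Rightarrow> real^'m^'q"
  assumes "prob_space M" "std_normal_matrix M X"
  obtains k where "k \<ge> 0"
    "distributed M lborel X (\<lambda>x. ennreal (k * exp (- trace (x ** transpose x) / 2)))"
proof -
  interpret prob_space M by fact
  let ?I = "UNIV :: ('q \<times> 'm) set"
  let ?P = "Pi\<^sub>M ?I (\<lambda>_. lborel :: real measure)"
  let ?B = "Pi\<^sub>M ?I (\<lambda>_. borel :: real measure)"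
  let ?N = "density lborel (\<lambda>x. ennreal (std_normal_density x))"
  let ?Y = "\<lambda>(i, j) \<omega>. X \<omega> $ i $ j"
  let ?v = "\<lambda>f. \<chi> i j. f (i, j) :: real^'m^'q"
  define h :: "real^'m^'q \<Rightarrow> ennreal" where
    "h x = (\<Prod>p\<in>?I. ennreal (std_normal_density (x $ fst p $ snd p)))" for x
  have indep: "indep_vars (\<lambda>_. borel) ?Y ?I"
    and dY: "distributed M lborel (\<lambda>\<omega>. X \<omega> $ i $ j) (\<lambda>x. ennreal (std_normal_density x))" for i j
    using assms(2) by (auto simp: std_normal_matrix_def)
  have Y: "(\<lambda>\<omega>. X \<omega> $ i $ j) \<in> borel_measurable M" for i j
    using distributed_measurable[OF dY[of i j]] by simp
  then have [measurable]: "X \<in> borel_measurable M"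
    by (rule borel_measurable_matrixI)
  have [measurable]: "?v \<in> borel_measurable ?P" "?v \<in> borel_measurable ?B"
    by (rule borel_measurable_matrixI; simp)+
  have [measurable]: "h \<in> borel_measurable borel"
    unfolding h_def by measurable
  have marg: "distr M borel (?Y p) = ?N" for p
  proof -
    have "distr M borel (?Y p) = distr M lborel (\<lambda>\<omega>. X \<omega> $ fst p $ snd p)"
      by (intro distr_cong) (auto simp: case_prod_unfold)
    then show ?thesis
      using distributed_distr_eq_density[OF dY] by simp
  qed
  have "distr M ?B (\<lambda>\<omega>. \<lambda>p\<in>?I. ?Y p \<omega>) = Pi\<^sub>M ?I (\<lambda>p. distr M borel (?Y p))"
    using indep by (subst (asm) indep_vars_iff_distr_eq_PiM) (auto simp: Y)
  also have "\<dots> = Pi\<^sub>M ?I (\<lambda>_. ?N)"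
    by (simp only: marg)
  also have "\<dots> = density ?P (\<lambda>f. h (?v f))"
  proof -
    interpret N: prob_space ?N by (rule prob_space_normal_density) simp
    interpret N: product_sigma_finite "\<lambda>_ :: 'q \<times> 'm. ?N" ..
    show ?thesis
    proof (rule N.PiM_eqI[symmetric])
      fix A :: "'q \<times> 'm \<Rightarrow> real set" assume "\<And>p. p \<in> ?I \<Longrightarrow> A p \<in> sets ?N"
      then have [measurable]: "A p \<in> sets borel" for p by simp
      have "Pi\<^sub>E ?I A \<in> sets ?P"
        by (rule sets_PiM_I_finite) auto
      then have "emeasure (density ?P (\<lambda>f. h (?v f))) (Pi\<^sub>E ?I A) =
          (\<integral>\<^sup>+f. h (?v f) * indicator (Pi\<^sub>E ?I A) f \<partial>?P)"
        by (subst emeasure_density) auto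
      also have "\<dots> = (\<integral>\<^sup>+f. (\<Prod>p\<in>?I. ennreal (std_normal_density (f p)) * indicator (A p) (f p)) \<partial>?P)"
      proof (rule nn_integral_cong)
        fix f :: "'q \<times> 'm \<Rightarrow> real"
        have "indicator (Pi\<^sub>E ?I A) f = (\<Prod>p\<in>?I. indicator (A p) (f p) :: ennreal)"
        proof (cases "f \<in> Pi\<^sub>E ?I A")
          case True
          then have "f p \<in> A p" for p by (metis PiE_mem UNIV_I)
          then show ?thesis using True by simp
        next
          case False
          then obtain p where "f p \<notin> A p" by auto
          then have "(\<Prod>p\<in>?I. indicator (A p) (f p) :: ennreal) = 0"
            by (intro prod_zero bexI[of _ p]) auto
          then show ?thesis using False by simp
        qed
        then show "h (?v f) * indicator (Pi\<^sub>E ?I A) f =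
            (\<Prod>p\<in>?I. ennreal (std_normal_density (f p)) * indicator (A p) (f p))"
          by (simp add: h_def prod.distrib)
      qed
      also have "\<dots> = (\<Prod>p\<in>?I. \<integral>\<^sup>+x. ennreal (std_normal_density x) * indicator (A p) x \<partial>lborel)"
        by (rule lborel_product.product_nn_integral_prod) auto
      also have "\<dots> = (\<Prod>p\<in>?I. emeasure ?N (A p))"
        by (simp add: emeasure_density)
      finally show "emeasure (density ?P (\<lambda>f. h (?v f))) (Pi\<^sub>E ?I A) = (\<Prod>p\<in>?I. emeasure ?N (A p))" .
    qed (auto intro!: sets_PiM_cong)
  qed
  finally have PiM_eq: "distr M ?B (\<lambda>\<omega>. \<lambda>p\<in>?I. ?Y p \<omega>) = density ?P (\<lambda>f. h (?v f))" .
  have "distr M lborel X = distr M borel (?v \<circ> (\<lambda>\<omega>. \<lambda>p\<in>?I. ?Y p \<omega>))"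
    by (intro distr_cong) (auto simp: vec_eq_iff)
  also have "\<dots> = distr (distr M ?B (\<lambda>\<omega>. \<lambda>p\<in>?I. ?Y p \<omega>)) borel ?v"
    by (rule distr_distr[symmetric]) (auto intro!: measurable_restrict simp: Y)
  also have "\<dots> = density (distr ?P borel ?v) h"
    unfolding PiM_eq by (rule density_distr[symmetric]) measurable
  finally have "distributed M lborel X h"
    unfolding distributed_def by (simp add: lborel_matrix_eq_distr[symmetric])
  have "h x = ennreal ((1 / sqrt (2 * pi)) ^ card ?I * exp (- trace (x ** transpose x) / 2))" for x
  proof -
    have "h x = ennreal (\<Prod>p\<in>?I. std_normal_density (x $ fst p $ snd p))"
      unfolding h_def by (rule prod_ennreal) simp
    also have "(\<Prod>p\<in>?I. std_normal_density (x $ fst p $ snd p)) =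
        (1 / sqrt (2 * pi)) ^ card ?I * exp (\<Sum>p\<in>?I. - (x $ fst p $ snd p)\<^sup>2 / 2)"
      unfolding std_normal_density_def prod.distrib by (simp add: exp_sum)
    also have "(\<Sum>p\<in>?I. - (x $ fst p $ snd p)\<^sup>2 / 2) = - trace (x ** transpose x) / 2"
      by (simp add: trace_def matrix_matrix_mult_def transpose_def sum_negf sum_divide_distrib
          power2_eq_square sum.cartesian_product case_prod_unfold)
    finally show ?thesis .
  qed
  then have "h = (\<lambda>x. ennreal ((1 / sqrt (2 * pi)) ^ card ?I * exp (- trace (x ** transpose x) / 2)))" ..
  with \<open>distributed M lborel X h\<close> show ?thesis
    by (intro that[of "(1 / sqrt (2 * pi)) ^ card ?I"]) simp_all
qed

text \<open>Independence is a product formula on measurable rectangles, which identifies the joint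
  law with the product of the two laws.\<close>

lemma indep_matrices_nn_integral:
  fixes S :: "'w \<Rightarrow> real^'a^'b" and X :: "'w \<Rightarrow> real^'c^'d"
  assumes "prob_space M" "indep_matrices M S X"
    and [measurable]: "S \<in> borel_measurable M" "X \<in> borel_measurable M"
      "g \<in> borel_measurable (borel \<Otimes>\<^sub>M borel)"
  shows "(\<integral>\<^sup>+\<omega>. g (S \<omega>, X \<omega>) \<partial>M) = (\<integral>\<^sup>+s. (\<integral>\<^sup>+x. g (s, x) \<partial>distr M borel X) \<partial>distr M borel S)"
proof -
  interpret prob_space M by fact
  interpret DS: prob_space "distr M borel S" by (rule prob_space_distr) simp
  interpret DX: prob_space "distr M borel X" by (rule prob_space_distr) simp
  have eq: "distr M borel S \<Otimes>\<^sub>M distr M borel X = distr M (borel \<Otimes>\<^sub>M borel) (\<lambda>\<omega>. (S \<omega>, X \<omega>))"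
  proof (rule pair_measure_eqI)
    show "sigma_finite_measure (distr M borel S)" "sigma_finite_measure (distr M borel X)"
      by unfold_locales
    fix A B assume AB: "A \<in> sets (distr M borel S)" "B \<in> sets (distr M borel X)"
    then have [measurable]: "A \<in> sets borel" "B \<in> sets borel" by auto
    have "prob ((S -` A \<inter> space M) \<inter> (X -` B \<inter> space M)) = prob (S -` A \<inter> space M) * prob (X -` B \<inter> space M)"
      by (rule indep_setD[OF assms(2)[unfolded indep_matrices_def]]) auto
    moreover have "(\<lambda>\<omega>. (S \<omega>, X \<omega>)) -` (A \<times> B) \<inter> space M = (S -` A \<inter> space M) \<inter> (X -` B \<inter> space M)"
      by auto
    ultimately show "emeasure (distr M borel S) A * emeasure (distr M borel X) B =
        emeasure (distr M (borel \<Otimes>\<^sub>M borel) (\<lambda>\<omega>. (S \<omega>, X \<omega>))) (A \<times> B)"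
      by (simp add: emeasure_distr emeasure_eq_measure ennreal_mult)
  qed (simp cong: sets_pair_measure_cong)
  have "(\<integral>\<^sup>+s. (\<integral>\<^sup>+x. g (s, x) \<partial>distr M borel X) \<partial>distr M borel S) =
      (\<integral>\<^sup>+z. g z \<partial>(distr M borel S \<Otimes>\<^sub>M distr M borel X))"
    by (subst DX.nn_integral_fst[symmetric]) (auto cong: measurable_cong_sets sets_pair_measure_cong)
  also have "\<dots> = (\<integral>\<^sup>+\<omega>. g (S \<omega>, X \<omega>) \<partial>M)"
    unfolding eq by (subst nn_integral_distr) auto
  finally show ?thesis by simp
qed

subsection \<open>Wishart densities\<close>

lemma posdef_mat_one: "posdef_mat (mat 1)"
  by (simp add: posdef_mat_def transpose_mat)

lemma multi_Gamma_pos: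
  assumes "a > (real l - 1) / 2"
  shows "multi_Gamma l a > 0"
proof -
  have "Gamma (a - (real j - 1) / 2) > 0" if "j \<in> {1..l}" for j
  proof (rule Gamma_real_pos)
    have "real j \<le> real l" using that by simp
    then have "(real j - 1) / 2 \<le> (real l - 1) / 2" by simp
    then show "a - (real j - 1) / 2 > 0" using assms by linarith
  qed
  then show ?thesis
    unfolding multi_Gamma_def by (intro mult_pos_pos prod_pos) auto
qed

lemma borel_measurable_wishart_density [measurable]:
  "wishart_density n \<Sigma> \<in> borel_measurable borel"
  unfolding wishart_density_def[abs_def] by measurable

text \<open>The bound on \<open>m\<close> makes the arguments of all Gamma factors positive, and
  thereby the normalizing constant.\<close>

lemma wishart_density_one:
  assumes "m > real CARD('q) - 1"
  obtains c where "c > 0" "\<And>Z :: real^'q^'q. wishart_density m (mat 1) Z =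
    (if posdef_mat Z then c * det Z powr ((m - real CARD('q) - 1) / 2) * exp (- trace Z / 2) else 0)"
proof
  let ?c = "1 / (2 powr (real CARD('q) * m / 2) * multi_Gamma CARD('q) (m / 2))"
  have "matrix_inv (mat 1 :: real^'q^'q) = mat 1"
    by (rule matrix_inv_eqI) simp
  then show "wishart_density m (mat 1) Z = (if posdef_mat Z then
      ?c * det Z powr ((m - real CARD('q) - 1) / 2) * exp (- trace Z / 2) else 0)" for Z :: "real^'q^'q"
    by (simp add: wishart_density_def)
  have "multi_Gamma CARD('q) (m / 2) > 0"
    using assms by (intro multi_Gamma_pos) simp
  then show "?c > 0" by simp
qed

text \<open>With a block diagonal parameter the trace term does not involve \<open>y\<close>, and
  the determinant splits off the Schur complement. All that is free of \<open>y\<close> goes into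
  \<open>c\<close>.\<close>

lemma wishart_joint_density_schur:
  fixes A11 \<Sigma>11 :: "real^'a^'a" and A22 \<Sigma>22 :: "real^'b^'b"
  assumes n: "n \<ge> real CARD('a) + real CARD('b)"
    and \<Sigma>: "posdef_mat (block_mat \<Sigma>11 0 0 \<Sigma>22)" and A11: "posdef_mat A11"
  obtains c where "c > 0" "\<And>y. wishart_joint_density n (block_mat \<Sigma>11 0 0 \<Sigma>22) A11 y A22 =
    ennreal (if posdef_mat (A22 - transpose y ** matrix_inv A11 ** y)
      then c * det (A22 - transpose y ** matrix_inv A11 ** y) powr ((n - real CARD('a) - real CARD('b) - 1) / 2)
      else 0)"
proof
  let ?\<Sigma> = "block_mat \<Sigma>11 0 0 \<Sigma>22"
  let ?e = "(n - real CARD('a) - real CARD('b) - 1) / 2"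
  let ?t = "trace (matrix_inv \<Sigma>11 ** A11) + trace (matrix_inv \<Sigma>22 ** A22)"
  let ?d = "det (block_mat A11 0 0 (mat 1 :: real^'b^'b))"
  let ?k = "2 powr (real CARD('a + 'b) * n / 2) * det ?\<Sigma> powr (n / 2) * multi_Gamma CARD('a + 'b) (n / 2)"
  let ?c = "?d powr ?e * exp (- (1 / 2) * ?t) / ?k"
  have inv: "matrix_inv ?\<Sigma> = block_mat (matrix_inv \<Sigma>11) 0 0 (matrix_inv \<Sigma>22)"
    using \<Sigma> by (intro matrix_inv_block_diag posdef_mat_invertible) (simp_all add: posdef_block_diag_iff)
  have tr: "trace (matrix_inv ?\<Sigma> ** block_mat A11 y (transpose y) A22) = ?t" for y
    by (simp add: inv block_mat_mult trace_block_mat)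
  have d: "?d > 0"
    by (intro det_posdef_mat_pos) (simp add: posdef_block_diag_iff A11 posdef_mat_one)
  have "multi_Gamma CARD('a + 'b) (n / 2) > 0"
    using n by (intro multi_Gamma_pos) simp
  then show "?c > 0"
    using d det_posdef_mat_pos[OF \<Sigma>] by simp
  have e: "(n - real CARD('a + 'b) - 1) / 2 = ?e" by simp
  show "wishart_joint_density n ?\<Sigma> A11 y A22 =
    ennreal (if posdef_mat (A22 - transpose y ** matrix_inv A11 ** y)
      then ?c * det (A22 - transpose y ** matrix_inv A11 ** y) powr ?e else 0)" for y
    unfolding wishart_joint_density_def wishart_density_def posdef_block_iff_schur[OF A11]
      det_block_schur[OF A11] tr e
    using d by (auto simp: powr_mult det_posdef_mat_pos less_imp_le mult.commute mult.left_commute)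
qed

section \<open>The substitution relating X and A12\<close>

text \<open>This confines the density of the pair (W, X) to positive definite W, the matrices on
  which the root is specified.\<close>

lemma posdef_mat_add_gram:
  fixes A :: "real^'q^'q" and x :: "real^'m^'q"
  assumes "posdef_mat A"
  shows "posdef_mat (A + x ** transpose x)"
  unfolding posdef_mat_def
proof (intro conjI allI impI)
  show "transpose (A + x ** transpose x) = A + x ** transpose x"
    using posdef_mat_sym[OF assms]
    by (simp add: transpose_def vec_eq_iff matrix_matrix_mult_def mult.commute)
  fix v :: "real^'q" assume "v \<noteq> 0"
  then have "v \<bullet> (A *v v) > 0"
    using assms by (simp add: posdef_mat_def)
  moreover have "v \<bullet> ((x ** transpose x) *v v) = (transpose x *v v) \<bullet> (transpose x *v v)"
    by (metis dot_lmul_matrix matrix_vector_mul_assoc transpose_matrix_vector)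
  ultimately show "v \<bullet> ((A + x ** transpose x) *v v) > 0"
    by (simp add: matrix_vector_mult_add_rdistrib inner_add_right add_pos_nonneg)
qed

lemma matrix_diff_ldistrib: "A ** (B - C) = A ** B - A ** C"
  for A :: "real^'n^'m" and B C :: "real^'k^'n"
  by (simp add: matrix_matrix_mult_def vec_eq_iff right_diff_distrib sum_subtractf)

lemma matrix_diff_rdistrib: "(A - B) ** C = A ** C - B ** C"
  for A B :: "real^'n^'m" and C :: "real^'k^'n"
  by (simp add: matrix_matrix_mult_def vec_eq_iff left_diff_distrib sum_subtractf)

text \<open>The root of \<open>A11\<close> cancels against its inverse, so the subtracted term is P
  x x^T P^T, while R R^T = W gives P W P^T = A22.\<close>

lemma schur_complement_transform:
  fixes A11 :: "real^'a^'a" and A22 W R :: "real^'b^'b" and x :: "real^'a^'b"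
  assumes A11: "posdef_mat A11" and A22: "posdef_mat A22"
    and R: "R ** transpose R = W" "invertible R"
  defines "P \<equiv> posdef_sqrt A22 ** matrix_inv R"
  defines "y \<equiv> transpose (P ** x ** posdef_sqrt A11)"
  shows "A22 - transpose y ** matrix_inv A11 ** y = P ** (W - x ** transpose x) ** transpose P"
proof -
  let ?C = "posdef_sqrt A11" and ?D = "posdef_sqrt A22"
  note C = posdef_mat_posdef_sqrt[OF A11] and D = posdef_mat_posdef_sqrt[OF A22]
  have sym: "transpose ?C = ?C" "transpose ?D = ?D"
    using C D by (simp_all add: posdef_mat_sym)
  have "A11 ** (matrix_inv ?C ** matrix_inv ?C) = ?C ** (?C ** matrix_inv ?C) ** matrix_inv ?C"
    by (simp add: posdef_sqrt_mult_self[OF A11] matrix_mul_assoc)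
  also have "\<dots> = mat 1"
    by (simp add: matrix_inv_right_inverse posdef_mat_invertible[OF C])
  finally have "matrix_inv A11 = matrix_inv ?C ** matrix_inv ?C"
    by (rule matrix_inv_eqI)
  then have "?C ** matrix_inv A11 ** ?C = (?C ** matrix_inv ?C) ** (matrix_inv ?C ** ?C)"
    by (simp add: matrix_mul_assoc)
  then have CAC: "?C ** matrix_inv A11 ** ?C = mat 1"
    by (simp add: matrix_inv_right_inverse matrix_inv_left_inverse posdef_mat_invertible[OF C])
  have "transpose y ** matrix_inv A11 ** y =
      P ** x ** (?C ** matrix_inv A11 ** ?C) ** transpose x ** transpose P"
    by (simp add: y_def matrix_transpose_mul sym matrix_mul_assoc)
  then have 1: "transpose y ** matrix_inv A11 ** y = P ** (x ** transpose x) ** transpose P"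
    by (simp add: CAC matrix_mul_assoc)
  have "P ** W ** transpose P =
      ?D ** (matrix_inv R ** R) ** transpose (matrix_inv R ** R) ** ?D"
    by (simp add: P_def matrix_transpose_mul sym matrix_mul_assoc flip: R(1))
  then have 2: "P ** W ** transpose P = A22"
    by (simp add: matrix_inv_left_inverse R(2) posdef_sqrt_mult_self[OF A22] transpose_mat)
  have "P ** (W - x ** transpose x) ** transpose P =
      P ** W ** transpose P - P ** (x ** transpose x) ** transpose P"
    by (simp only: matrix_diff_ldistrib matrix_diff_rdistrib)
  then show ?thesis using 1 2 by simp
qed

lemma linear_matrix_sandwich: "linear (\<lambda>x. transpose (P ** x ** C))"
  for P :: "real^'b^'b" and C :: "real^'a^'a"
  by (rule linearI)
    (simp_all add: vec_eq_iff transpose_def matrix_matrix_mult_def sum.distrib sum_distrib_left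
      algebra_simps)

section \<open>The law of A12\<close>

theorem theorem1:
  fixes M :: "'w measure"
    and n :: real
    and \<Sigma>11 A11 :: "real^'l1^'l1"
    and \<Sigma>22 A22 :: "real^'l2^'l2"
    and \<Sigma> :: "real^('l1 + 'l2)^('l1 + 'l2)"
    and S :: "'w \<Rightarrow> real^'l2^'l2"
    and X :: "'w \<Rightarrow> real^'l1^'l2"
    and A12 :: "'w \<Rightarrow> real^'l2^'l1"
    and root :: "real^'l2^'l2 \<Rightarrow> real^'l2^'l2"
  assumes "prob_space M"
    and "n \<ge> real CARD('l1) + real CARD('l2)"
    and "\<Sigma> = block_mat \<Sigma>11 0 0 \<Sigma>22"
    and "posdef_mat \<Sigma>"
    and "posdef_mat A11"
    and "posdef_mat A22"
    and "wishart_distributed M (n - real CARD('l1)) (mat 1) S"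
    and "std_normal_matrix M X"
    and "indep_matrices M S X"
    and "root \<in> borel_measurable borel"
    and "\<And>W. posdef_mat W \<Longrightarrow> root W ** transpose (root W) = W"
    and "\<And>\<omega>. \<omega> \<in> space M \<Longrightarrow>
           transpose (A12 \<omega>) =
             posdef_sqrt A22 ** matrix_inv (root (S \<omega> + X \<omega> ** transpose (X \<omega>)))
               ** X \<omega> ** posdef_sqrt A11"
  shows "distributed M lborel A12 (wishart_cond_density n \<Sigma> A11 A22)"
proof -
  interpret prob_space M by fact
  \<comment> \<open>\<open>R W\<close> is the factor \<open>P\<close> of
    \<open>schur_complement_transform\<close>; \<open>root W\<close> takes the place of the
    \<open>R\<close> there.\<close>
  define R :: "real^'l2^'l2 \<Rightarrow> real^'l2^'l2" where
    "R W = posdef_sqrt A22 ** matrix_inv (root W)" for W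
  define Y :: "real^'l2^'l2 \<Rightarrow> real^'l1^'l2 \<Rightarrow> real^'l2^'l1" where
    "Y W x = transpose (R W ** x ** posdef_sqrt A11)" for W x
  define J where "J y = wishart_joint_density n \<Sigma> A11 y A22" for y
  define G where "G = (\<integral>\<^sup>+y. J y \<partial>lborel)"
  \<comment> \<open>The exponent shared by the density of \<open>S\<close> and by
    \<open>J\<close>.\<close>
  define e where "e = (n - real CARD('l1) - real CARD('l2) - 1) / 2"
  note n = assms(2) and \<Sigma> = assms(4)[unfolded assms(3)] and A11 = assms(5) and A22 = assms(6)
    and root = assms(11)
  note [measurable] = assms(10)
  have [measurable]: "R \<in> borel_measurable borel"
    unfolding R_def by measurable
  have Y_measurable [measurable]: "(\<lambda>z. Y (f z) (g z)) \<in> borel_measurable N"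
    if [measurable]: "f \<in> borel_measurable N" "g \<in> borel_measurable N" for f g and N :: "'z measure"
    unfolding Y_def by measurable
  have [measurable]: "J \<in> borel_measurable borel"
    unfolding J_def wishart_joint_density_def by measurable

  obtain cS where cS: "cS > 0" "\<And>Z :: real^'l2^'l2. wishart_density (n - real CARD('l1)) (mat 1) Z =
    (if posdef_mat Z then cS * det Z powr e * exp (- trace Z / 2) else 0)"
    using wishart_density_one[where 'q='l2, of "n - real CARD('l1)"] n unfolding e_def by auto
  obtain cJ where cJ: "cJ > 0" "\<And>y. J y =
    ennreal (if posdef_mat (A22 - transpose y ** matrix_inv A11 ** y)
      then cJ * det (A22 - transpose y ** matrix_inv A11 ** y) powr e else 0)"
    using wishart_joint_density_schur[OF n \<Sigma> A11, of A22] unfolding J_def e_def assms(3) by blast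
  obtain k where k: "k \<ge> 0"
    "distributed M lborel X (\<lambda>x. ennreal (k * exp (- trace (x ** transpose x) / 2)))"
    using distributed_std_normal_matrix[OF assms(1,8)] .
  have S: "distributed M sym_lborel S (\<lambda>A. ennreal (wishart_density (n - real CARD('l1)) (mat 1) A))"
    using assms(7) by (simp add: wishart_distributed_def)
  have [measurable]: "S \<in> borel_measurable M" "X \<in> borel_measurable M"
    using distributed_measurable[OF S] distributed_measurable[OF k(2)]
    by (simp_all cong: measurable_cong_sets)
  have A12: "A12 \<omega> = Y (S \<omega> + X \<omega> ** transpose (X \<omega>)) (X \<omega>)" if "\<omega> \<in> space M" for \<omega>
    using arg_cong[OF assms(12)[OF that], of transpose] by (simp add: Y_def R_def)
  have A12_measurable [measurable]: "A12 \<in> borel_measurable M"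
    by (subst measurable_cong[OF A12]) measurable

  \<comment> \<open>The joint density of (W, X) after the shear.\<close>
  define D where "D W x = ennreal (wishart_density (n - real CARD('l1)) (mat 1) (W - x ** transpose x)) *
    ennreal (k * exp (- trace (x ** transpose x) / 2))" for W :: "real^'l2^'l2" and x :: "real^'l1^'l2"
  \<comment> \<open>What remains of \<open>D W x\<close> after division by \<open>J (Y W x)\<close>.
    The power of \<open>det (R W)\<close> compensates for the congruence by \<open>R W\<close>
    inside \<open>J\<close>.\<close>
  define a where "a W = k * cS * exp (- trace W / 2) / (cJ * ((det (R W))\<^sup>2) powr e)" for W
  \<comment> \<open>The Jacobian factor of \<open>Y W\<close>, as the volume of the preimage of the
    unit box under \<open>- Y W\<close>.\<close>
  define c where "c W = (\<integral>\<^sup>+x. indicator (box 0 One) (- Y W x) \<partial>lborel :: ennreal)" for W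
  define K where "K = (\<integral>\<^sup>+W. (if posdef_mat W then ennreal (a W) * c W else 0) \<partial>sym_lborel)"
  have [measurable]: "a \<in> borel_measurable borel"
    unfolding a_def by measurable
  have [measurable]: "c \<in> borel_measurable borel"
    unfolding c_def by measurable

  have inv_root: "invertible (root W)" if "posdef_mat W" for W
  proof -
    have "(det (root W))\<^sup>2 = det W"
      using det_mul[of "root W" "transpose (root W)"] by (simp add: root[OF that] power2_eq_square)
    then show ?thesis
      using det_posdef_mat_pos[OF that] by (auto simp: invertible_det_nz)
  qed
  have inv_R: "invertible (R W)" if "posdef_mat W" for W
  proof -
    have "root W ** matrix_inv (root W) = mat 1" "matrix_inv (root W) ** root W = mat 1"
      by (simp_all add: inv_root[OF that] matrix_inv_right_inverse matrix_inv_left_inverse)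
    then have "invertible (matrix_inv (root W))"
      unfolding invertible_def by blast
    then show ?thesis
      unfolding R_def by (rule invertible_mult[OF posdef_mat_invertible[OF posdef_mat_posdef_sqrt[OF A22]]])
  qed
  have D_eq: "D W x = (if posdef_mat W then ennreal (a W) * J (Y W x) else 0)" for W x
  proof (cases "posdef_mat W")
    \<comment> \<open>If \<open>W\<close> is not positive definite, neither is W - x x^T, and both
      sides vanish.\<close>
    case False
    then have "\<not> posdef_mat (W - x ** transpose x)"
      using posdef_mat_add_gram[of "W - x ** transpose x" x] by auto
    then show ?thesis using False by (simp add: D_def cS(2))
  next
    case True
    let ?Z = "W - x ** transpose x"
    note inv_root = inv_root[OF True] and inv_R = inv_R[OF True]
    have schur: "A22 - transpose (Y W x) ** matrix_inv A11 ** Y W x = R W ** ?Z ** transpose (R W)"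
      unfolding Y_def R_def by (rule schur_complement_transform[OF A11 A22 root[OF True] inv_root])
    have det: "det (R W ** ?Z ** transpose (R W)) = (det (R W))\<^sup>2 * det ?Z"
      by (simp add: det_mul power2_eq_square)
    have pos: "(det (R W))\<^sup>2 powr e > 0"
      using inv_R by (simp add: invertible_det_nz)
    show ?thesis
    proof (cases "posdef_mat ?Z")
      case False
      then show ?thesis
        using True by (simp add: D_def cS(2) cJ(2) schur posdef_mat_congruence_iff[OF inv_R])
    next
      case Z: True
      have "D W x = ennreal (cS * det ?Z powr e * exp (- trace ?Z / 2) * (k * exp (- trace (x ** transpose x) / 2)))"
        using k(1) cS(1) Z by (simp add: D_def cS(2) ennreal_mult)
      \<comment> \<open>Here tr S + tr (X X^T) = tr W removes \<open>x\<close> from the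
        exponential.\<close>
      also have "exp (- trace W / 2) = exp (- trace ?Z / 2) * exp (- trace (x ** transpose x) / 2)"
        by (simp add: trace_sub exp_add[symmetric] diff_divide_distrib)
      then have "cS * det ?Z powr e * exp (- trace ?Z / 2) * (k * exp (- trace (x ** transpose x) / 2))
          = a W * (cJ * ((det (R W))\<^sup>2 powr e * det ?Z powr e))"
        using pos cJ(1) by (simp add: a_def)
      also have "ennreal \<dots> = ennreal (a W) * J (Y W x)"
        using Z k(1) cS(1) cJ(1) pos det_posdef_mat_pos[OF Z]
        by (subst ennreal_mult) (auto simp: a_def cJ(2) schur posdef_mat_congruence_iff[OF inv_R] det powr_mult)
      finally show ?thesis using True by simp
    qed
  qed

  \<comment> \<open>At fixed \<open>W\<close> the test function sees \<open>x\<close> only through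
    \<open>Y W x\<close>, so the substitution separates \<open>W\<close> from the integral against
    \<open>J\<close>.\<close>
  have inner: "(\<integral>\<^sup>+x. D W x * h (Y W x) \<partial>lborel) =
      (if posdef_mat W then ennreal (a W) * c W else 0) * (\<integral>\<^sup>+y. J y * h y \<partial>lborel)"
    if [measurable]: "h \<in> borel_measurable borel" for W and h :: "real^'l2^'l1 \<Rightarrow> ennreal"
  proof (cases "posdef_mat W")
    case True
    have "linear (Y W)"
      unfolding Y_def[abs_def] by (rule linear_matrix_sandwich)
    \<comment> \<open>An explicit right inverse of \<open>Y W\<close>, as the linear change of
      variables demands.\<close>
    moreover have "Y W (matrix_inv (R W) ** transpose y ** matrix_inv (posdef_sqrt A11)) = y" for y
    proof -
      have "Y W (matrix_inv (R W) ** transpose y ** matrix_inv (posdef_sqrt A11)) =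
        transpose ((R W ** matrix_inv (R W)) ** transpose y **
          (matrix_inv (posdef_sqrt A11) ** posdef_sqrt A11))"
        by (simp add: Y_def matrix_mul_assoc)
      then show ?thesis
        using inv_R[OF True] posdef_mat_invertible[OF posdef_mat_posdef_sqrt[OF A11]]
        by (simp add: matrix_inv_right_inverse matrix_inv_left_inverse)
    qed
    moreover have "(\<integral>\<^sup>+y. indicator (box 0 One) y \<partial>(lborel :: (real^'l2^'l1) measure)) = 1"
      by (simp add: emeasure_lborel_box_eq)
    ultimately have "(\<integral>\<^sup>+x. J (Y W x) * h (Y W x) \<partial>lborel) = c W * (\<integral>\<^sup>+y. J y * h y \<partial>lborel)"
      unfolding c_def by (intro nn_integral_lborel_linear[where g="\<lambda>y. J y * h y"]) auto
    then show ?thesis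
      using True by (simp add: D_eq nn_integral_cmult mult.assoc)
  qed (simp add: D_eq)

  have integral_A12: "(\<integral>\<^sup>+\<omega>. h (A12 \<omega>) \<partial>M) = K * (\<integral>\<^sup>+y. J y * h y \<partial>lborel)"
    if [measurable]: "h \<in> borel_measurable borel" for h :: "real^'l2^'l1 \<Rightarrow> ennreal"
  proof -
    let ?d = "\<lambda>A :: real^'l2^'l2. ennreal (wishart_density (n - real CARD('l1)) (mat 1) A)"
    let ?\<phi> = "\<lambda>x :: real^'l1^'l2. ennreal (k * exp (- trace (x ** transpose x) / 2))"
    let ?h = "\<lambda>s x. h (Y (s + x ** transpose x) x)"
    have distr_S: "distr M borel S = density sym_lborel ?d"
      using distributed_distr_eq_density[OF S] by (simp cong: distr_cong)
    have distr_X: "distr M borel X = density lborel ?\<phi>"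
      using distributed_distr_eq_density[OF k(2)] by (simp cong: distr_cong)
    have "(\<integral>\<^sup>+\<omega>. h (A12 \<omega>) \<partial>M) = (\<integral>\<^sup>+\<omega>. ?h (S \<omega>) (X \<omega>) \<partial>M)"
      by (intro nn_integral_cong) (simp add: A12)
    also have "\<dots> = (\<integral>\<^sup>+s. (\<integral>\<^sup>+x. ?h s x \<partial>distr M borel X) \<partial>distr M borel S)"
      using indep_matrices_nn_integral[OF assms(1,9), of "\<lambda>(s, x). ?h s x"] by simp
    also have "\<dots> = (\<integral>\<^sup>+s. ?d s * (\<integral>\<^sup>+x. ?\<phi> x * ?h s x \<partial>lborel) \<partial>sym_lborel)"
      unfolding distr_S distr_X by (simp add: nn_integral_density)
    also have "\<dots> = (\<integral>\<^sup>+s. (\<integral>\<^sup>+x. ?d s * (?\<phi> x * ?h s x) \<partial>lborel) \<partial>sym_lborel)"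
      by (simp add: nn_integral_cmult)
    \<comment> \<open>The shear replaces s by W - x x^T, so the argument of \<open>Y\<close> becomes
      \<open>W\<close> itself.\<close>
    also have "\<dots> = (\<integral>\<^sup>+W. (\<integral>\<^sup>+x. D W x * h (Y W x) \<partial>lborel) \<partial>sym_lborel)"
      using sym_lborel_shear[of "\<lambda>(s, x). ?d s * (?\<phi> x * ?h s x)" "\<lambda>x. x ** transpose x"]
      by (simp add: D_def mult.assoc matrix_transpose_mul)
    also have "\<dots> = K * (\<integral>\<^sup>+y. J y * h y \<partial>lborel)"
      by (simp add: inner K_def nn_integral_multc)
    finally show ?thesis .
  qed
  \<comment> \<open>The constant test function 1 compares total masses.\<close>
  have "K * G = 1"
    using integral_A12[of "\<lambda>_. 1"] by (simp add: G_def emeasure_space_1)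
  \<comment> \<open>In \<open>ennreal\<close> a product with 0 is 0 and a product with \<top> is 0
    or \<top>, never 1.\<close>
  then have "G \<noteq> 0" "G \<noteq> \<top>"
    by (auto simp: ennreal_mult_top split: if_splits)
  then have "G * inverse G = 1"
    using ennreal_divide_self[of G] by (simp add: divide_ennreal_def less_top)
  then have "inverse G = K"
    using \<open>K * G = 1\<close> by (metis mult.assoc mult.commute mult.right_neutral)
  show ?thesis
    unfolding distributed_def
  proof (intro conjI)
    have dens: "wishart_cond_density n \<Sigma> A11 A22 = (\<lambda>y. J y * K)"
      by (simp add: fun_eq_iff wishart_cond_density_def wishart_diag_marginal_density_def
          divide_ennreal_def \<open>inverse G = K\<close>[symmetric] G_def J_def)
    then show "wishart_cond_density n \<Sigma> A11 A22 \<in> borel_measurable lborel"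
      by simp
    show "distr M lborel A12 = density lborel (wishart_cond_density n \<Sigma> A11 A22)"
    proof (rule measure_eqI)
      fix B assume "B \<in> sets (distr M lborel A12)"
      then have [measurable]: "B \<in> sets borel" by simp
      have "emeasure (distr M lborel A12) B = (\<integral>\<^sup>+\<omega>. indicator B (A12 \<omega>) \<partial>M)"
        by (simp add: nn_integral_distr flip: nn_integral_indicator)
      also have "\<dots> = (\<integral>\<^sup>+y. K * (J y * indicator B y) \<partial>lborel)"
        by (simp add: integral_A12 nn_integral_cmult)
      also have "\<dots> = emeasure (density lborel (wishart_cond_density n \<Sigma> A11 A22)) B"
        by (simp add: dens emeasure_density mult_ac)
      finally show "emeasure (distr M lborel A12) B =
        emeasure (density lborel (wishart_cond_density n \<Sigma> A11 A22)) B" .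
    qed simp
  qed simp
qed

end
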